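(* Let $F$ be a field, let $A$ be a finitely generated torsion-free abelian group, and let $\mathcal A = F \ast A$ be a twisted group algebra of $A$ over $F$. Let $B$ be a subgroup of $A$ such that $A/B$ is infinite cyclic, generated by $tB$ with $t \in A$; let $\mathcal B = F \ast B \subseteq \mathcal A$ and $S = \mathcal B\setminus\{0\}$, and let $\Sigma = \mathcal A S^{-1}$. Let $\mathfrak m$ be a maximal right ideal of $\Sigma$ and let $S(\mathfrak m) = \mathcal A/(\mathcal A \cap \mathfrak m)$. If $\mathcal B$ is commutative, $\mathcal A$ has center $F$, and $\mathcal A\cap\mathfrak m$ contains an element unitary with respect to $\bar t$, then $S(\mathfrak m)$ is a simple $\mathcal A$-module.
   Context: A twisted group algebra $F \ast A$ of a finitely generated torsion-free abelian group $A$ over a field $F$ is an associative $A$-graded algebra $\bigoplus_{a \in A} F\bar a$ (so $\{\bar a : a \in A\}$ is an $F$-basis) with multiplication $\bar a_1 \bar a_2 = \lambda(a_1,a_2)\overline{a_1a_2}$, where $\lambda : A \times A \to F^* = F\setminus\{0\}$ satisfies the 2-cocycle condition $\lambda(a_1,a_2)\lambda(a_1a_2,a_3) = \lambda(a_2,a_3)\lambda(a_1,a_2a_3)$ for all $a_1,a_2,a_3 \in A$. For a subgroup $B \le A$, $F \ast B = \bigoplus_{b\in B} F\bar b$ is the subalgebra of elements supported in $B$. Modules are right modules. If $A/B = \langle tB\rangle$ is infinite cyclic, then $\mathcal A = \mathcal B[\bar t^{\pm 1},\sigma]$ is a skew-Laurent extension, where $\sigma(\beta) = \bar t\beta\bar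 t^{-1}$ for $\beta\in\mathcal B$. The set $S = \mathcal B\setminus\{0\}$ is an Ore subset of $\mathcal A$, and the corresponding ring of fractions is the skew-Laurent polynomial ring $\Sigma = \mathcal A S^{-1} = \mathscr D[\bar t^{\pm1},\sigma]$, where $\mathscr D = \mathcal B S^{-1}$ is the quotient division ring of $\mathcal B$; $\Sigma$ is a (noncommutative) principal ideal domain containing $\mathcal A$. An element $\alpha\in\mathcal A$ is unitary with respect to $\bar t$ if in its unique expression $\alpha = \sum_{i=p}^q \beta_i\bar t^i$ with $p\le q$ in $\mathbb Z$ and $\beta_i\in\mathcal B$, the terminal coefficients $\beta_p$ and $\beta_q$ are units of $\mathcal B$. *)

theory Defs
  imports "HOL-Algebra.Algebra"
begin

section \<open>Right ideals and right modules\<close>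

locale right_ideal = additive_subgroup I R + ring R for I and R (structure) +
  assumes I_r_closed: "\<lbrakk>a \<in> I; x \<in> carrier R\<rbrakk> \<Longrightarrow> a \<otimes> x \<in> I"

definition maximal_right_ideal :: "'r set \<Rightarrow> ('r, 'n) ring_scheme \<Rightarrow> bool" where
  "maximal_right_ideal I R \<longleftrightarrow> right_ideal I R \<and> I \<noteq> carrier R \<and>
     (\<forall>J. right_ideal J R \<and> I \<subseteq> J \<longrightarrow> J = I \<or> J = carrier R)"

text \<open>As in the library's \<^type>\<open>module\<close> record, the fields \<open>mult\<close> and \<open>one\<close> inherited from
  the ring record play no role. The term \<open>ract M x r\<close> stands for \<open>x r\<close>.\<close>

record ('m, 'r) right_module_struct = "'m ring" +
  ract :: "'m \<Rightarrow> 'r \<Rightarrow> 'm"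

locale right_module = R?: ring R + M?: abelian_group M
  for R :: "('r, 'n) ring_scheme" and M :: "('m, 'r, 'z) right_module_struct_scheme" +
  assumes ract_closed: "\<lbrakk>x \<in> carrier M; r \<in> carrier R\<rbrakk> \<Longrightarrow> ract M x r \<in> carrier M"
    and ract_add_left: "\<lbrakk>x \<in> carrier M; y \<in> carrier M; r \<in> carrier R\<rbrakk>
      \<Longrightarrow> ract M (x \<oplus>\<^bsub>M\<^esub> y) r = ract M x r \<oplus>\<^bsub>M\<^esub> ract M y r"
    and ract_add_right: "\<lbrakk>x \<in> carrier M; r \<in> carrier R; s \<in> carrier R\<rbrakk>
      \<Longrightarrow> ract M x (r \<oplus>\<^bsub>R\<^esub> s) = ract M x r \<oplus>\<^bsub>M\<^esub> ract M x s"
    and ract_mult: "\<lbrakk>x \<in> carrier M; r \<in> carrier R; s \<in> carrier R\<rbrakk>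
      \<Longrightarrow> ract M x (r \<otimes>\<^bsub>R\<^esub> s) = ract M (ract M x r) s"
    and ract_one: "x \<in> carrier M \<Longrightarrow> ract M x \<one>\<^bsub>R\<^esub> = x"

definition right_submodule ::
  "'m set \<Rightarrow> ('r, 'n) ring_scheme \<Rightarrow> ('m, 'r, 'z) right_module_struct_scheme \<Rightarrow> bool" where
  "right_submodule N R M \<longleftrightarrow> additive_subgroup N M \<and>
     (\<forall>x\<in>N. \<forall>r\<in>carrier R. ract M x r \<in> N)"

definition simple_right_module ::
  "('r, 'n) ring_scheme \<Rightarrow> ('m, 'r, 'z) right_module_struct_scheme \<Rightarrow> bool" where
  "simple_right_module R M \<longleftrightarrow> right_module R M \<and> carrier M \<noteq> {\<zero>\<^bsub>M\<^esub>} \<and>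
     (\<forall>N. right_submodule N R M \<longrightarrow> N = {\<zero>\<^bsub>M\<^esub>} \<or> N = carrier M)"

text \<open>The right module \<open>R/I\<close>, for a right ideal \<open>I\<close>: \<open>(I + x) r = I + x r\<close>.\<close>

definition right_quotient_module ::
  "('r, 'n) ring_scheme \<Rightarrow> 'r set \<Rightarrow> ('r set, 'r) right_module_struct" where
  "right_quotient_module R I =
     \<lparr>carrier = a_rcosets\<^bsub>R\<^esub> I, monoid.mult = undefined, one = undefined,
      ring.zero = I, ring.add = set_add R,
      ract = (\<lambda>C r. \<Union>x\<in>C. I +>\<^bsub>R\<^esub> (x \<otimes>\<^bsub>R\<^esub> r))\<rparr>"

section \<open>Rings of fractions and centers\<close>

text \<open>\<open>Q\<close>, together with \<open>\<iota> : R \<rightarrow> Q\<close>, is a ring of right fractions \<open>R S\<^sup>-\<^sup>1\<close>. Such a ring exists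
  iff \<open>S\<close> satisfies the right Ore and right reversibility conditions, and is then unique up to
  a unique isomorphism compatible with \<open>\<iota>\<close>.\<close>

definition right_ring_of_fractions ::
  "('r, 'n) ring_scheme \<Rightarrow> 'r set \<Rightarrow> ('q, 'k) ring_scheme \<Rightarrow> ('r \<Rightarrow> 'q) \<Rightarrow> bool" where
  "right_ring_of_fractions R S Q \<iota> \<longleftrightarrow>
     ring Q \<and> \<iota> \<in> ring_hom R Q \<and>
     (\<forall>s\<in>S. \<iota> s \<in> Units Q) \<and>
     (\<forall>q\<in>carrier Q. \<exists>r\<in>carrier R. \<exists>s\<in>S. q = \<iota> r \<otimes>\<^bsub>Q\<^esub> inv\<^bsub>Q\<^esub> (\<iota> s)) \<and>
     (\<forall>r\<in>carrier R. \<iota> r = \<zero>\<^bsub>Q\<^esub> \<longleftrightarrow> (\<exists>s\<in>S. r \<otimes>\<^bsub>R\<^esub> s = \<zero>\<^bsub>R\<^esub>))"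

definition ring_center :: "('r, 'n) ring_scheme \<Rightarrow> 'r set" where
  "ring_center R = {z \<in> carrier R. \<forall>x\<in>carrier R. z \<otimes>\<^bsub>R\<^esub> x = x \<otimes>\<^bsub>R\<^esub> z}"

section \<open>Finitely generated torsion-free groups\<close>

definition finitely_generated_group :: "('a, 'n) monoid_scheme \<Rightarrow> bool" where
  "finitely_generated_group G \<longleftrightarrow>
     (\<exists>S. finite S \<and> S \<subseteq> carrier G \<and> generate G S = carrier G)"

definition torsion_free_group :: "('a, 'n) monoid_scheme \<Rightarrow> bool" where
  "torsion_free_group G \<longleftrightarrow>
     (\<forall>x\<in>carrier G. \<forall>n::nat. 0 < n \<and> x [^]\<^bsub>G\<^esub> n = \<one>\<^bsub>G\<^esub> \<longrightarrow> x = \<one>\<^bsub>G\<^esub>)"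

section \<open>Twisted group algebras\<close>

definition two_cocycle ::
  "('f, 'm) ring_scheme \<Rightarrow> ('a, 'n) monoid_scheme \<Rightarrow> ('a \<Rightarrow> 'a \<Rightarrow> 'f) \<Rightarrow> bool" where
  "two_cocycle F A lam \<longleftrightarrow>
     (\<forall>a\<in>carrier A. \<forall>b\<in>carrier A. lam a b \<in> carrier F - {\<zero>\<^bsub>F\<^esub>}) \<and>
     (\<forall>a\<in>carrier A. \<forall>b\<in>carrier A. \<forall>c\<in>carrier A.
        lam a b \<otimes>\<^bsub>F\<^esub> lam (a \<otimes>\<^bsub>A\<^esub> b) c = lam b c \<otimes>\<^bsub>F\<^esub> lam a (b \<otimes>\<^bsub>A\<^esub> c))"

definition supp :: "('f, 'm) ring_scheme \<Rightarrow> ('a \<Rightarrow> 'f) \<Rightarrow> 'a set" where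
  "supp F \<alpha> = {a. \<alpha> a \<noteq> \<zero>\<^bsub>F\<^esub>}"

text \<open>The basis element \<open>a\<close>-bar.\<close>

definition tga_basis :: "('f, 'm) ring_scheme \<Rightarrow> 'a \<Rightarrow> 'a \<Rightarrow> 'f" where
  "tga_basis F a = (\<lambda>x. if x = a then \<one>\<^bsub>F\<^esub> else \<zero>\<^bsub>F\<^esub>)"

text \<open>An element of \<open>F * A\<close> is its coefficient function, extended by zero outside \<open>carrier A\<close>.
  The cocycle is not assumed to be normalized; the cocycle condition gives
  \<open>lam 1 a = lam 1 1 = lam a 1\<close>, so the identity element is \<open>(lam 1 1)\<^sup>-\<^sup>1\<close> times the
  basis element of the group identity.\<close>

definition twisted_group_algebra ::
  "('f, 'm) ring_scheme \<Rightarrow> ('a, 'n) monoid_scheme \<Rightarrow> ('a \<Rightarrow> 'a \<Rightarrow> 'f) \<Rightarrow> ('a \<Rightarrow> 'f) ring" where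
  "twisted_group_algebra F A lam =
     \<lparr>carrier = {\<alpha>. (\<forall>a. \<alpha> a \<in> carrier F) \<and> supp F \<alpha> \<subseteq> carrier A \<and> finite (supp F \<alpha>)},
      monoid.mult = (\<lambda>\<alpha> \<beta> c. \<Oplus>\<^bsub>F\<^esub>a \<in> supp F \<alpha>. \<Oplus>\<^bsub>F\<^esub>b \<in> {b \<in> supp F \<beta>. a \<otimes>\<^bsub>A\<^esub> b = c}.
                lam a b \<otimes>\<^bsub>F\<^esub> (\<alpha> a \<otimes>\<^bsub>F\<^esub> \<beta> b)),
      one = (\<lambda>c. inv\<^bsub>F\<^esub> (lam \<one>\<^bsub>A\<^esub> \<one>\<^bsub>A\<^esub>) \<otimes>\<^bsub>F\<^esub> tga_basis F \<one>\<^bsub>A\<^esub> c),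
      ring.zero = (\<lambda>c. \<zero>\<^bsub>F\<^esub>),
      ring.add = (\<lambda>\<alpha> \<beta> c. \<alpha> c \<oplus>\<^bsub>F\<^esub> \<beta> c)\<rparr>"

text \<open>The subalgebra \<open>F * B\<close> of \<open>F * A\<close>, as a set.\<close>

definition tga_supported ::
  "('f, 'm) ring_scheme \<Rightarrow> ('a, 'n) monoid_scheme \<Rightarrow> ('a \<Rightarrow> 'a \<Rightarrow> 'f) \<Rightarrow> 'a set \<Rightarrow> ('a \<Rightarrow> 'f) set"
  where
  "tga_supported F A lam B =
     {\<alpha> \<in> carrier (twisted_group_algebra F A lam). supp F \<alpha> \<subseteq> B}"

text \<open>The copy of \<open>F\<close> in \<open>F * A\<close>: the scalar multiples of the identity element.\<close>

definition tga_scalars ::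
  "('f, 'm) ring_scheme \<Rightarrow> ('a, 'n) monoid_scheme \<Rightarrow> ('a \<Rightarrow> 'a \<Rightarrow> 'f) \<Rightarrow> ('a \<Rightarrow> 'f) set" where
  "tga_scalars F A lam =
     {(\<lambda>a. k \<otimes>\<^bsub>F\<^esub> \<one>\<^bsub>twisted_group_algebra F A lam\<^esub> a) | k. k \<in> carrier F}"

text \<open>\<open>K\<close> is the carrier of a subring of \<open>R\<close>, and \<open>u\<close> is a unit of \<open>R\<close>. The unit condition is
  about units of \<open>K\<close>, not merely units of \<open>R\<close> lying in \<open>K\<close>.\<close>

definition unitary_wrt :: "('r, 'n) ring_scheme \<Rightarrow> 'r set \<Rightarrow> 'r \<Rightarrow> 'r \<Rightarrow> bool" where
  "unitary_wrt R K u \<alpha> \<longleftrightarrow>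
     (\<exists>p q :: int. \<exists>\<beta>. p \<le> q \<and> \<beta> \<in> {p..q} \<rightarrow> K \<and>
        \<alpha> = (\<Oplus>\<^bsub>R\<^esub>i\<in>{p..q}. \<beta> i \<otimes>\<^bsub>R\<^esub> (u [^]\<^bsub>R\<^esub> i)) \<and>
        \<beta> p \<in> Units (R\<lparr>carrier := K\<rparr>) \<and> \<beta> q \<in> Units (R\<lparr>carrier := K\<rparr>))"

end

theory Submission
  imports Defs
begin

text \<open>
  Let \<open>I = \<A> \<inter> \<mm>\<close> and let \<open>J\<close> be a right ideal of \<open>\<A>\<close> properly containing \<open>I\<close>. Maximality
  of \<open>\<mm>\<close> gives \<open>1 = m + x q\<close> with \<open>m \<in> \<mm>\<close> and \<open>x \<in> J\<close>; clearing the denominator of \<open>q\<close> produces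
  a nonzero \<open>s\<^sub>0 \<in> J \<inter> \<B>\<close>. A product of conjugates of \<open>s\<^sub>0\<close> under powers of \<open>u\<close>, the basis element
  of \<open>t\<close>, is a nonzero \<open>s \<in> \<B>\<close> with \<open>u\<^sup>i s \<in> J\<close> for \<open>i\<close> in a given finite window, and multiples of the
  unitary element of \<open>J\<close> extend a window of the right length to all integers, so \<open>\<A> s \<subseteq> J\<close>. Hence
  the two-sided ideal \<open>{x. \<A> x \<subseteq> J}\<close>, the annihilator of \<open>\<A>/J\<close>, is nonzero. But \<open>\<A>\<close> is a simple
  ring: in a nonzero ideal choose an element of minimal support containing the group identity;
  its commutators with the monomials have smaller support, hence vanish, so it is central, i.e.
  a nonzero scalar. Therefore \<open>J = \<A>\<close>.
\<close>

section \<open>Right ideals and simple quotients\<close>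

text \<open>Closure under negation comes from right multiples: \<open>x\<close> times minus one is
  minus \<open>x\<close>. Only sums and products remain to be checked.\<close>

lemma right_idealI:
  assumes "ring R" "I \<subseteq> carrier R" "\<zero>\<^bsub>R\<^esub> \<in> I"
    and add: "\<And>x y. \<lbrakk>x \<in> I; y \<in> I\<rbrakk> \<Longrightarrow> x \<oplus>\<^bsub>R\<^esub> y \<in> I"
    and mult: "\<And>x r. \<lbrakk>x \<in> I; r \<in> carrier R\<rbrakk> \<Longrightarrow> x \<otimes>\<^bsub>R\<^esub> r \<in> I"
  shows "right_ideal I R"
proof -
  interpret ring R by fact
  have "\<ominus>\<^bsub>R\<^esub> x \<in> I" if "x \<in> I" for x
    using mult[OF that, of "\<ominus>\<^bsub>R\<^esub> \<one>\<^bsub>R\<^esub>"] that assms(2) by (auto simp: r_minus)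
  then have "subgroup I (add_monoid R)"
    using assms by (intro add.subgroupI) (auto simp: a_inv_def)
  then show ?thesis
    using mult by (intro right_ideal.intro right_ideal_axioms.intro additive_subgroup.intro) (auto intro: assms(1))
qed

context right_ideal
begin

lemma abelian_subgroup_I: "abelian_subgroup I R"
  by (rule abelian_subgroupI3) unfold_locales

abbreviation coset :: "'a \<Rightarrow> 'a set" where "coset x \<equiv> I +>\<^bsub>R\<^esub> x"

abbreviation "Q \<equiv> right_quotient_module R I"

lemma coset_eq_iff:
  assumes "x \<in> carrier R" "y \<in> carrier R"
  shows "coset x = coset y \<longleftrightarrow> x \<ominus> y \<in> I"
proof -
  interpret abelian_subgroup I R by (rule abelian_subgroup_I)
  show ?thesis
    using assms a_rcos_module_minus[OF ring_axioms, of y x] a_repr_independence' a_repr_independenceD by blast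
qed

lemma carrier_quotient: "carrier Q = coset ` carrier R"
  and zero_quotient: "\<zero>\<^bsub>Q\<^esub> = I"
  by (auto simp: right_quotient_module_def A_RCOSETS_def' a_r_coset_def')

lemma quotient_add:
  "\<lbrakk>x \<in> carrier R; y \<in> carrier R\<rbrakk> \<Longrightarrow> coset x \<oplus>\<^bsub>Q\<^esub> coset y = coset (x \<oplus> y)"
  by (simp add: right_quotient_module_def abelian_subgroup.a_rcos_sum[OF abelian_subgroup_I])

text \<open>The action is a union over all representatives of the coset. Two representatives differ
  by an element of \<open>I\<close>, and \<open>I\<close> absorbs factors on the right, so all of
  them contribute the same coset; the union is over a nonempty set because \<open>x\<close>
  represents its own coset.\<close>

lemma quotient_ract:
  assumes "x \<in> carrier R" "r \<in> carrier R"
  shows "ract Q (coset x) r = coset (x \<otimes> r)"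
proof -
  interpret abelian_subgroup I R by (rule abelian_subgroup_I)
  have x: "x \<in> coset x" using assms by (simp add: a_rcos_self)
  have "coset (y \<otimes> r) = coset (x \<otimes> r)" if y: "y \<in> coset x" for y
  proof -
    have yc: "y \<in> carrier R" using y assms a_r_coset_subset_G[OF a_subset] by blast
    have "y \<ominus> x \<in> I" using y yc assms(1) a_rcos_module_minus[OF ring_axioms] by blast
    then have "(y \<ominus> x) \<otimes> r \<in> I" using assms by (intro I_r_closed)
    then have "y \<otimes> r \<ominus> x \<otimes> r \<in> I" using assms yc by (simp add: minus_eq l_distr l_minus)
    then show ?thesis using assms yc by (simp add: coset_eq_iff)
  qed
  then have "(\<Union>y\<in>coset x. coset (y \<otimes> r)) = coset (x \<otimes> r)"
    using x by (intro SUP_eq_const) blast+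
  then show ?thesis by (simp add: right_quotient_module_def)
qed

lemma coset_zero: "coset \<zero> = I"
  using a_subset by (rule a_coset_add_zero)

lemma quotient_cases [consumes 1, case_names coset]:
  assumes "C \<in> carrier Q" obtains x where "x \<in> carrier R" "C = coset x"
  using assms by (auto simp: carrier_quotient)

lemma coset_closed: "x \<in> carrier R \<Longrightarrow> coset x \<in> carrier Q"
  by (simp add: carrier_quotient)

lemma abelian_group_quotient: "abelian_group Q"
proof (rule abelian_groupI)
  fix C assume "C \<in> carrier Q"
  then obtain x where x: "x \<in> carrier R" "C = coset x" by (rule quotient_cases)
  then have "coset (\<ominus> x) \<oplus>\<^bsub>Q\<^esub> C = \<zero>\<^bsub>Q\<^esub>"
    by (simp add: quotient_add l_neg coset_zero zero_quotient)
  then show "\<exists>D\<in>carrier Q. D \<oplus>\<^bsub>Q\<^esub> C = \<zero>\<^bsub>Q\<^esub>" using x coset_closed[of "\<ominus> x"] by auto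
  show "\<zero>\<^bsub>Q\<^esub> \<oplus>\<^bsub>Q\<^esub> C = C"
    using quotient_add[of \<zero> x] x by (simp add: coset_zero zero_quotient)
  fix D assume "D \<in> carrier Q"
  then obtain y where y: "y \<in> carrier R" "D = coset y" by (rule quotient_cases)
  show "C \<oplus>\<^bsub>Q\<^esub> D \<in> carrier Q" using x y by (simp add: quotient_add coset_closed)
  show "C \<oplus>\<^bsub>Q\<^esub> D = D \<oplus>\<^bsub>Q\<^esub> C" using x y by (simp add: quotient_add a_comm)
  fix E assume "E \<in> carrier Q"
  then obtain z where z: "z \<in> carrier R" "E = coset z" by (rule quotient_cases)
  show "C \<oplus>\<^bsub>Q\<^esub> D \<oplus>\<^bsub>Q\<^esub> E = C \<oplus>\<^bsub>Q\<^esub> (D \<oplus>\<^bsub>Q\<^esub> E)"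
    using x y z by (simp add: quotient_add a_assoc)
next
  show "\<zero>\<^bsub>Q\<^esub> \<in> carrier Q" using coset_closed[of \<zero>] by (simp add: coset_zero zero_quotient)
qed

lemma right_module_quotient: "right_module R Q"
proof (intro right_module.intro right_module_axioms.intro ring_axioms abelian_group_quotient)
  fix C r assume "C \<in> carrier Q" and r: "r \<in> carrier R"
  then obtain x where x: "x \<in> carrier R" "C = coset x" by (meson quotient_cases)
  show "ract Q C r \<in> carrier Q" using x r by (simp add: quotient_ract coset_closed)
  fix s assume s: "s \<in> carrier R"
  show "ract Q C (r \<oplus> s) = ract Q C r \<oplus>\<^bsub>Q\<^esub> ract Q C s"
    using x r s by (simp add: quotient_ract quotient_add r_distr)
  show "ract Q C (r \<otimes> s) = ract Q (ract Q C r) s"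
    using x r s by (simp add: quotient_ract m_assoc)
next
  fix C D r assume "C \<in> carrier Q" "D \<in> carrier Q" and r: "r \<in> carrier R"
  then obtain x y where "x \<in> carrier R" "C = coset x" "y \<in> carrier R" "D = coset y"
    by (meson quotient_cases)
  then show "ract Q (C \<oplus>\<^bsub>Q\<^esub> D) r = ract Q C r \<oplus>\<^bsub>Q\<^esub> ract Q D r"
    using r by (simp add: quotient_ract quotient_add l_distr)
next
  fix C assume "C \<in> carrier Q"
  then obtain x where x: "x \<in> carrier R" "C = coset x" by (meson quotient_cases)
  show "ract Q C \<one> = C" using x by (simp add: quotient_ract)
qed

text \<open>One half of the correspondence between submodules of the quotient and right ideals above
  \<open>I\<close>; it lets maximality of \<open>I\<close> speak about submodules.\<close>

lemma submodule_preimage: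
  assumes "right_submodule N R Q"
  shows "right_ideal {x \<in> carrier R. coset x \<in> N} R"
proof -
  interpret N: additive_subgroup N Q using assms by (simp add: right_submodule_def)
  have "ract Q C r \<in> N" if "C \<in> N" "r \<in> carrier R" for C r
    using assms that by (simp add: right_submodule_def)
  then have "coset (x \<otimes> r) \<in> N" if "x \<in> carrier R" "coset x \<in> N" "r \<in> carrier R" for x r
    using that by (metis quotient_ract)
  moreover have "coset (x \<oplus> y) \<in> N"
    if "x \<in> carrier R" "coset x \<in> N" "y \<in> carrier R" "coset y \<in> N" for x y
    using that N.a_closed by (metis quotient_add)
  ultimately show ?thesis
    using N.zero_closed by (intro right_idealI ring_axioms) (auto simp: coset_zero zero_quotient)
qed

end

text \<open>A submodule is determined by its preimage in \<open>R\<close>, a right ideal containing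
  \<open>I\<close>, and maximality leaves two choices for that preimage. Properness of
  \<open>I\<close> makes the quotient nonzero. The final theorem thereby becomes a statement about
  right ideals only.\<close>

theorem maximal_imp_simple_quotient:
  assumes "maximal_right_ideal I R"
  shows "simple_right_module R (right_quotient_module R I)"
proof -
  interpret right_ideal I R using assms by (simp add: maximal_right_ideal_def)
  have proper: "I \<noteq> carrier R"
    and maximal: "\<And>J. \<lbrakk>right_ideal J R; I \<subseteq> J\<rbrakk> \<Longrightarrow> J = I \<or> J = carrier R"
    using assms by (auto simp: maximal_right_ideal_def)
  have mem: "coset x = I \<longleftrightarrow> x \<in> I" if "x \<in> carrier R" for x
    using that coset_eq_iff[of x "\<zero>\<^bsub>R\<^esub>"] by (simp add: coset_zero minus_eq)
  have "carrier Q \<noteq> {\<zero>\<^bsub>Q\<^esub>}"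
    using proper a_subset mem by (auto simp: carrier_quotient zero_quotient)
  moreover have "N = {\<zero>\<^bsub>Q\<^esub>} \<or> N = carrier Q" if N: "right_submodule N R Q" for N
  proof -
    interpret N: additive_subgroup N Q using N by (simp add: right_submodule_def)
    let ?J = "{x \<in> carrier R. coset x \<in> N}"
    have sub: "N \<subseteq> coset ` carrier R" using N.a_subset by (simp add: carrier_quotient)
    have I: "I \<in> N" using N.zero_closed by (simp add: zero_quotient)
    have "coset x \<in> N" if "x \<in> I" for x using that mem[of x] a_subset I by auto
    then have "I \<subseteq> ?J" using a_subset by blast
    then consider "?J = I" | "?J = carrier R" using maximal[OF submodule_preimage[OF N]] by blast
    then show ?thesis
    proof cases
      case 1
      then have "N = {I}" using sub I mem by auto
      then show ?thesis by (simp add: zero_quotient)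
    next
      case 2
      then show ?thesis using sub by (auto simp: carrier_quotient)
    qed
  qed
  ultimately show ?thesis
    using right_module_quotient by (simp add: simple_right_module_def)
qed

section \<open>Right ideals of rings of fractions\<close>

text \<open>The ring of fractions contains \<open>R\<close> only through \<open>h\<close>, so the
  intersection of \<open>R\<close> with a right ideal of \<open>Q\<close> is expressed as a
  preimage.\<close>

lemma right_ideal_preimage:
  assumes "ring_hom_ring R Q h" and "right_ideal M Q"
  shows "right_ideal {x \<in> carrier R. h x \<in> M} R"
proof -
  interpret ring_hom_ring R Q h by fact
  interpret M: right_ideal M Q by fact
  show ?thesis
    by (rule right_idealI) (auto simp: R.ring_axioms M.a_closed M.I_r_closed)
qed

text \<open>This is \<open>M + yQ\<close>, to be compared with a maximal \<open>M\<close> when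
  \<open>y\<close> lies outside it.\<close>

lemma right_ideal_adjoin:
  assumes "right_ideal M Q" and y: "y \<in> carrier Q"
  shows "right_ideal {m \<oplus>\<^bsub>Q\<^esub> y \<otimes>\<^bsub>Q\<^esub> q | m q. m \<in> M \<and> q \<in> carrier Q} Q" (is "right_ideal ?N Q")
proof -
  interpret M: right_ideal M Q by fact
  have N: "m \<oplus>\<^bsub>Q\<^esub> y \<otimes>\<^bsub>Q\<^esub> q \<in> ?N" if "m \<in> M" "q \<in> carrier Q" for m q using that by blast
  show ?thesis
  proof (rule right_idealI[OF M.ring_axioms])
    show "?N \<subseteq> carrier Q" using M.a_subset y by auto
    show "\<zero>\<^bsub>Q\<^esub> \<in> ?N" using N[of "\<zero>\<^bsub>Q\<^esub>" "\<zero>\<^bsub>Q\<^esub>"] y by simp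
  next
    fix a b assume "a \<in> ?N" "b \<in> ?N"
    then obtain m q n r where mq: "m \<in> M" "q \<in> carrier Q" "a = m \<oplus>\<^bsub>Q\<^esub> y \<otimes>\<^bsub>Q\<^esub> q"
      and nr: "n \<in> M" "r \<in> carrier Q" "b = n \<oplus>\<^bsub>Q\<^esub> y \<otimes>\<^bsub>Q\<^esub> r" by blast
    have "a \<oplus>\<^bsub>Q\<^esub> b = (m \<oplus>\<^bsub>Q\<^esub> n) \<oplus>\<^bsub>Q\<^esub> y \<otimes>\<^bsub>Q\<^esub> (q \<oplus>\<^bsub>Q\<^esub> r)"
      using mq nr y M.a_Hcarr by (simp add: M.r_distr M.a_ac)
    then show "a \<oplus>\<^bsub>Q\<^esub> b \<in> ?N"
      using N[of "m \<oplus>\<^bsub>Q\<^esub> n" "q \<oplus>\<^bsub>Q\<^esub> r"] mq nr M.a_closed by simp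
  next
    fix a r assume "a \<in> ?N" and r: "r \<in> carrier Q"
    then obtain m q where mq: "m \<in> M" "q \<in> carrier Q" "a = m \<oplus>\<^bsub>Q\<^esub> y \<otimes>\<^bsub>Q\<^esub> q" by blast
    have "a \<otimes>\<^bsub>Q\<^esub> r = m \<otimes>\<^bsub>Q\<^esub> r \<oplus>\<^bsub>Q\<^esub> y \<otimes>\<^bsub>Q\<^esub> (q \<otimes>\<^bsub>Q\<^esub> r)"
      using mq y r M.a_Hcarr by (simp add: M.l_distr M.m_assoc)
    then show "a \<otimes>\<^bsub>Q\<^esub> r \<in> ?N"
      using N[of "m \<otimes>\<^bsub>Q\<^esub> r" "q \<otimes>\<^bsub>Q\<^esub> r"] mq r M.I_r_closed by simp
  qed
qed

text \<open>By maximality \<open>M + h(x)Q\<close> contains one, say \<open>1 = m + h(x) q\<close>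
  with \<open>q = h(r) h(s)^-1\<close>. Multiplying by \<open>h(s)\<close> on the right gives
  \<open>h(s - x r) = m h(s)\<close>, which lies in \<open>M\<close>. So \<open>s - x r\<close> lies
  in \<open>J\<close>, and with \<open>x r\<close> also \<open>s\<close> does.\<close>

lemma right_ideal_meets_denominators:
  assumes "ring R" and frac: "right_ring_of_fractions R S Q h" and S: "S \<subseteq> carrier R"
    and max: "maximal_right_ideal M Q" and "right_ideal J R"
    and sub: "{x \<in> carrier R. h x \<in> M} \<subseteq> J" and x: "x \<in> J" "h x \<notin> M"
  shows "\<exists>s\<in>S. s \<in> J"
proof -
  interpret Q: ring Q using frac by (simp add: right_ring_of_fractions_def)
  interpret h: ring_hom_ring R Q h
    using frac assms(1) by (intro ring_hom_ringI2) (simp_all add: right_ring_of_fractions_def)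
  interpret M: right_ideal M Q using max by (simp add: maximal_right_ideal_def)
  interpret J: right_ideal J R by fact
  have xc: "x \<in> carrier R" using x(1) J.a_Hcarr by blast
  then have hx: "h x \<in> carrier Q" by simp
  let ?N = "{m \<oplus>\<^bsub>Q\<^esub> h x \<otimes>\<^bsub>Q\<^esub> q | m q. m \<in> M \<and> q \<in> carrier Q}"
  have "m \<in> ?N" if "m \<in> M" for m
  proof -
    have "m = m \<oplus>\<^bsub>Q\<^esub> h x \<otimes>\<^bsub>Q\<^esub> \<zero>\<^bsub>Q\<^esub>" using that M.a_Hcarr hx by simp
    then show ?thesis using that Q.zero_closed by blast
  qed
  moreover have "h x \<in> ?N"
  proof -
    have "h x = \<zero>\<^bsub>Q\<^esub> \<oplus>\<^bsub>Q\<^esub> h x \<otimes>\<^bsub>Q\<^esub> \<one>\<^bsub>Q\<^esub>" using hx by simp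
    then show ?thesis using M.zero_closed Q.one_closed by blast
  qed
  \<comment> \<open>\<open>?N\<close> contains \<open>M\<close> and also \<open>h x\<close>, which
    lies outside \<open>M\<close>, so maximality leaves only the whole ring.\<close>
  ultimately have "?N = carrier Q"
    using max right_ideal_adjoin[OF M.right_ideal_axioms hx] x(2)
    unfolding maximal_right_ideal_def by blast
  then obtain m q where m: "m \<in> M" and q: "q \<in> carrier Q" and one: "\<one>\<^bsub>Q\<^esub> = m \<oplus>\<^bsub>Q\<^esub> h x \<otimes>\<^bsub>Q\<^esub> q"
    using Q.one_closed by blast
  obtain r s where r: "r \<in> carrier R" and s: "s \<in> S" and qrs: "q = h r \<otimes>\<^bsub>Q\<^esub> inv\<^bsub>Q\<^esub> (h s)"
    using frac q unfolding right_ring_of_fractions_def by blast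
  have sc: "s \<in> carrier R" using s S by blast
  have hs: "h s \<in> Units Q" using frac s unfolding right_ring_of_fractions_def by blast
  have mc: "m \<in> carrier Q" using m M.a_Hcarr by blast
  have "h s = (m \<oplus>\<^bsub>Q\<^esub> h x \<otimes>\<^bsub>Q\<^esub> q) \<otimes>\<^bsub>Q\<^esub> h s" using sc by (simp flip: one)
  also have "\<dots> = m \<otimes>\<^bsub>Q\<^esub> h s \<oplus>\<^bsub>Q\<^esub> h x \<otimes>\<^bsub>Q\<^esub> h r"
    using mc hx r sc hs by (simp add: qrs Q.l_distr Q.m_assoc)
  finally have "h (s \<ominus>\<^bsub>R\<^esub> x \<otimes>\<^bsub>R\<^esub> r) = m \<otimes>\<^bsub>Q\<^esub> h s \<oplus>\<^bsub>Q\<^esub> h x \<otimes>\<^bsub>Q\<^esub> h r \<ominus>\<^bsub>Q\<^esub> h x \<otimes>\<^bsub>Q\<^esub> h r"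
    using sc xc r by (simp add: h.R.minus_eq Q.minus_eq)
  also have "\<dots> = m \<otimes>\<^bsub>Q\<^esub> h s"
    using mc hx r sc by (simp add: Q.minus_eq Q.a_assoc Q.r_neg)
  finally have "h (s \<ominus>\<^bsub>R\<^esub> x \<otimes>\<^bsub>R\<^esub> r) \<in> M" using M.I_r_closed[OF m] sc by simp
  then have "s \<ominus>\<^bsub>R\<^esub> x \<otimes>\<^bsub>R\<^esub> r \<in> J" using sub sc xc r by auto
  then have "s \<ominus>\<^bsub>R\<^esub> x \<otimes>\<^bsub>R\<^esub> r \<oplus>\<^bsub>R\<^esub> x \<otimes>\<^bsub>R\<^esub> r \<in> J" using J.a_closed J.I_r_closed[OF x(1) r] by blast
  then have "s \<in> J" using sc xc r by (simp add: h.R.minus_eq h.R.a_assoc h.R.l_neg)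
  then show ?thesis using s by blast
qed

text \<open>Denominators become units in \<open>Q\<close>, a product of units is a unit, and zero is
  a unit only in the zero ring. With \<open>S\<close> the nonzero elements of \<open>F * B\<close>,
  this shows that \<open>F * B\<close> has no zero divisors.\<close>

lemma denominators_mult_nonzero:
  assumes "ring R" and frac: "right_ring_of_fractions R S Q h" and S: "S \<subseteq> carrier R"
    and "\<one>\<^bsub>Q\<^esub> \<noteq> \<zero>\<^bsub>Q\<^esub>" and s: "s \<in> S" "s' \<in> S"
  shows "s \<otimes>\<^bsub>R\<^esub> s' \<noteq> \<zero>\<^bsub>R\<^esub>"
proof
  interpret Q: ring Q using frac by (simp add: right_ring_of_fractions_def)
  interpret h: ring_hom_ring R Q h
    using frac assms(1) by (intro ring_hom_ringI2) (simp_all add: right_ring_of_fractions_def)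
  assume "s \<otimes>\<^bsub>R\<^esub> s' = \<zero>\<^bsub>R\<^esub>"
  moreover have "s \<in> carrier R" "s' \<in> carrier R" using s S by blast+
  ultimately have "h s \<otimes>\<^bsub>Q\<^esub> h s' = \<zero>\<^bsub>Q\<^esub>" using h.hom_mult h.hom_zero by metis
  moreover have "h s \<in> Units Q" "h s' \<in> Units Q"
    using frac s unfolding right_ring_of_fractions_def by blast+
  then have "h s \<otimes>\<^bsub>Q\<^esub> h s' \<in> Units Q" by (rule Q.Units_m_closed)
  ultimately have "\<zero>\<^bsub>Q\<^esub> \<in> Units Q" by simp
  then have "\<one>\<^bsub>Q\<^esub> = \<zero>\<^bsub>Q\<^esub>" using Q.Units_r_inv[of "\<zero>\<^bsub>Q\<^esub>"] Q.Units_inv_closed[of "\<zero>\<^bsub>Q\<^esub>"] by (metis Q.l_null)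
  then show False using assms(4) by blast
qed

section \<open>Subrings normalized by the powers of a unit\<close>

context monoid
begin

text \<open>Integer powers of a unit may be computed in the group of units; the laws of exponents
  below are inherited from there.\<close>

lemma units_of_int_pow:
  assumes "x \<in> Units G" shows "x [^]\<^bsub>units_of G\<^esub> (i::int) = x [^] i"
proof -
  interpret U: group "units_of G" by (rule units_group)
  have n: "x [^] n \<in> Units G" for n :: nat
    using U.nat_pow_closed[of x n] assms by (simp add: units_of_pow units_of_carrier)
  show ?thesis
    by (simp only: int_pow_def2 units_of_pow[OF assms] units_of_inv[OF n])
qed

lemma Units_int_pow_closed:
  assumes "x \<in> Units G" shows "x [^] (i::int) \<in> Units G"
  using group.int_pow_closed[OF units_group, of x i] assms
  by (simp add: units_of_carrier units_of_int_pow)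

lemma Units_int_pow_add:
  assumes "x \<in> Units G" shows "x [^] (i + j :: int) = x [^] i \<otimes> x [^] j"
  using group.int_pow_mult[OF units_group, of x i j] assms
  by (simp add: units_of_carrier units_of_int_pow units_of_mult)

end

text \<open>For infinite \<open>S\<close> the sum is zero by convention, and zero lies in
  \<open>H\<close>.\<close>

lemma (in additive_subgroup) finsum_closed:
  assumes "abelian_group G" "\<And>i. i \<in> S \<Longrightarrow> f i \<in> H"
  shows "(\<Oplus>i\<in>S. f i) \<in> H"
proof -
  interpret abelian_group G by fact
  have H: "H \<subseteq> carrier G" by (rule a_subset)
  show ?thesis
  proof (cases "finite S")
    case True
    then show ?thesis using assms(2)
    proof (induction S rule: finite_induct)
      case (insert i S)
      have "f \<in> S \<rightarrow> carrier G" "f i \<in> carrier G" using insert.prems H by auto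
      then have "(\<Oplus>i\<in>insert i S. f i) = f i \<oplus> (\<Oplus>i\<in>S. f i)"
        using insert.hyps by (intro finsum_insert)
      then show ?case using insert by (simp add: a_closed)
    qed simp
  qed simp
qed

text \<open>An abstraction of the skew-Laurent situation: \<open>K\<close> stands for the
  commutative domain \<open>F * B\<close> and \<open>u\<close> for the basis element of
  \<open>t\<close>, whose powers normalize \<open>F * B\<close>.\<close>

locale normalized_subring = ring R for R (structure) +
  fixes K :: "'a set" and u :: 'a
  assumes subring_K: "subring K R"
    and K_comm: "\<lbrakk>x \<in> K; y \<in> K\<rbrakk> \<Longrightarrow> x \<otimes> y = y \<otimes> x"
    and K_domain: "\<lbrakk>x \<in> K; y \<in> K; x \<otimes> y = \<zero>\<rbrakk> \<Longrightarrow> x = \<zero> \<or> y = \<zero>"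
    and u_unit: "u \<in> Units R"
    and conj_K: "b \<in> K \<Longrightarrow> inv (u [^] (i::int)) \<otimes> b \<otimes> u [^] i \<in> K"
begin

lemma K_closed: "b \<in> K \<Longrightarrow> b \<in> carrier R"
  using subringE(1)[OF subring_K] by blast

lemma pow_Units: "u [^] (i::int) \<in> Units R"
  by (rule Units_int_pow_closed[OF u_unit])

lemma pow_closed: "u [^] (i::int) \<in> carrier R" "inv (u [^] (i::int)) \<in> carrier R"
  using pow_Units by auto

lemma pow_cancel:
  assumes "x \<in> carrier R"
  shows "u [^] (i::int) \<otimes> (inv (u [^] i) \<otimes> x) = x" "inv (u [^] i) \<otimes> (u [^] i \<otimes> x) = x"
  using assms pow_closed pow_Units by (simp_all flip: m_assoc)

text \<open>This is \<sigma> to the power \<open>- i\<close>, where \<sigma> sends \<open>b\<close>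
  to \<open>u b u^-1\<close>. The sign is chosen so that coefficients pass from the left of a power
  of \<open>u\<close> to its right, where a right ideal absorbs them.\<close>

definition twist :: "int \<Rightarrow> 'a \<Rightarrow> 'a" where
  "twist i b = inv (u [^] i) \<otimes> b \<otimes> u [^] i"

lemma twist_closed: "b \<in> K \<Longrightarrow> twist i b \<in> K"
  by (simp add: twist_def conj_K)

lemma twist_move: "b \<in> K \<Longrightarrow> b \<otimes> u [^] i = u [^] i \<otimes> twist i b"
  by (simp add: twist_def m_assoc pow_closed K_closed pow_cancel)

lemma twist_one: "twist i \<one> = \<one>"
  using pow_closed pow_Units by (simp add: twist_def)

lemma twist_mult:
  assumes "b \<in> K" "c \<in> K" shows "twist i (b \<otimes> c) = twist i b \<otimes> twist i c"
  using assms by (simp add: twist_def m_assoc pow_closed K_closed pow_cancel)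

lemma twist_eq_zero:
  assumes b: "b \<in> K" and z: "twist i b = \<zero>" shows "b = \<zero>"
proof -
  have "b \<otimes> u [^] i = \<zero>" using twist_move[OF b, of i] z pow_closed by simp
  moreover have "b = b \<otimes> u [^] i \<otimes> inv (u [^] i)"
    using pow_closed pow_Units by (simp add: m_assoc K_closed[OF b])
  ultimately show ?thesis using pow_closed by simp
qed

text \<open>Each new exponent \<open>j\<close> contributes one more factor, the conjugate
  \<open>twist j s0\<close>: moving \<open>s0\<close> past \<open>u^j\<close> shows that
  \<open>u^j\<close> times this conjugate is \<open>s0 u^j\<close>, which lies in \<open>J\<close>.
  The product of the conjugates is nonzero because \<open>K\<close> is a domain.\<close>

lemma exists_annihilator_on_finite:
  fixes N :: "int set"
  assumes "right_ideal J R" and s0: "s0 \<in> K" "s0 \<in> J" "s0 \<noteq> \<zero>" and "finite N"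
  shows "\<exists>s\<in>K - {\<zero>}. \<forall>i\<in>N. u [^] i \<otimes> s \<in> J"
  using \<open>finite N\<close>
proof (induction N rule: finite_induct)
  case empty
  show ?case using s0 by blast
next
  case (insert j N)
  interpret J: right_ideal J R by fact
  from insert.IH obtain s where s: "s \<in> K" "s \<noteq> \<zero>" "\<forall>i\<in>N. u [^] i \<otimes> s \<in> J" by blast
  let ?c = "twist j s0"
  have c: "?c \<in> K" "?c \<noteq> \<zero>" using s0 twist_closed twist_eq_zero by blast+
  have "u [^] j \<otimes> ?c \<in> J"
    using J.I_r_closed[OF s0(2)] pow_closed by (simp flip: twist_move[OF s0(1)])
  then have "u [^] j \<otimes> ?c \<otimes> s \<in> J" using J.I_r_closed s(1) K_closed by blast
  \<comment> \<open>By commutativity of \<open>K\<close> the product of \<open>s\<close> and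
    \<open>?c\<close> can be read both ways: \<open>?c\<close> stands next to the power of
    \<open>u\<close> for the new exponent, \<open>s\<close> for the old ones.\<close>
  then have "u [^] j \<otimes> (s \<otimes> ?c) \<in> J"
    using s(1) c(1) by (simp add: m_assoc pow_closed K_closed K_comm)
  moreover have "u [^] i \<otimes> (s \<otimes> ?c) \<in> J" if "i \<in> N" for i
    using J.I_r_closed[of "u [^] i \<otimes> s" ?c] s c that by (simp add: m_assoc pow_closed K_closed)
  moreover have "s \<otimes> ?c \<in> K - {\<zero>}"
    using s c K_domain subringE(6)[OF subring_K] by blast
  ultimately show ?case by blast
qed

text \<open>Multiply \<open>\<alpha>\<close> by \<open>u\<^sup>j s\<close> and move everything in \<open>K\<close> to the right of the powers of \<open>u\<close>:
  all terms but the one with the unit coefficient are already known to lie in \<open>J\<close>.\<close>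

lemma extend_window:
  fixes p q j :: int
  assumes "right_ideal J R" and \<beta>: "\<beta> \<in> {p..q} \<rightarrow> K"
    and \<alpha>: "(\<Oplus>i\<in>{p..q}. \<beta> i \<otimes> u [^] i) \<in> J"
    and r: "r \<in> {p..q}" "\<beta> r \<in> Units (R\<lparr>carrier := K\<rparr>)"
    and s: "s \<in> K" and J: "\<And>i. \<lbrakk>i \<in> {p..q}; i \<noteq> r\<rbrakk> \<Longrightarrow> u [^] (i + j) \<otimes> s \<in> J"
  shows "u [^] (r + j) \<otimes> s \<in> J"
proof -
  interpret J: right_ideal J R by fact
  let ?f = "\<lambda>i. u [^] (i + j) \<otimes> s \<otimes> twist (i + j) (\<beta> i)"
  have \<beta>K: "\<beta> i \<in> K" if "i \<in> {p..q}" for i using \<beta> that by blast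
  have move: "\<beta> i \<otimes> u [^] i \<otimes> (u [^] j \<otimes> s) = ?f i" if i: "i \<in> {p..q}" for i
  proof -
    have "\<beta> i \<otimes> u [^] i \<otimes> (u [^] j \<otimes> s) = \<beta> i \<otimes> u [^] (i + j) \<otimes> s"
      using K_closed[OF \<beta>K[OF i]] K_closed[OF s] pow_closed
      by (simp add: m_assoc Units_int_pow_add[OF u_unit])
    also have "\<dots> = u [^] (i + j) \<otimes> twist (i + j) (\<beta> i) \<otimes> s"
      by (simp add: twist_move[OF \<beta>K[OF i]])
    also have "\<dots> = ?f i"
      using twist_closed[OF \<beta>K[OF i]] s by (simp add: m_assoc pow_closed K_closed K_comm)
    finally show ?thesis .
  qed
  have f: "?f i \<in> carrier R" if "i \<in> {p..q}" for i
    using twist_closed[OF \<beta>K[OF that]] s pow_closed K_closed by simp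
  have fin: "finite ({p..q} - {r})" "r \<notin> {p..q} - {r}" "insert r ({p..q} - {r}) = {p..q}"
    using r by auto
  \<comment> \<open>The index \<open>r\<close> of the unit coefficient is split off; every other
    summand is a right multiple of some \<open>u^(i + j) s\<close> already known to lie in
    \<open>J\<close>.\<close>
  let ?rest = "\<Oplus>i\<in>{p..q} - {r}. ?f i"
  have "(\<Oplus>i\<in>{p..q}. \<beta> i \<otimes> u [^] i) \<otimes> (u [^] j \<otimes> s) = (\<Oplus>i\<in>{p..q}. \<beta> i \<otimes> u [^] i \<otimes> (u [^] j \<otimes> s))"
    using \<beta>K s pow_closed K_closed by (intro finsum_ldistr) auto
  also have "\<dots> = (\<Oplus>i\<in>{p..q}. ?f i)"
    by (rule finsum_cong') (use f move in blast)+
  also have "\<dots> = ?f r \<oplus> ?rest"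
    unfolding fin(3) [symmetric, THEN arg_cong, of "finsum R ?f"]
    by (rule finsum_insert[OF fin(1,2)]) (use f r(1) in blast)+
  finally have eq: "(\<Oplus>i\<in>{p..q}. \<beta> i \<otimes> u [^] i) \<otimes> (u [^] j \<otimes> s) = ?f r \<oplus> ?rest" .
  have "?f r \<oplus> ?rest \<in> J"
    unfolding eq [symmetric] using J.I_r_closed[OF \<alpha>] s pow_closed K_closed by simp
  moreover have rest: "?rest \<in> J"
  proof (rule J.finsum_closed[OF abelian_group_axioms])
    fix i assume "i \<in> {p..q} - {r}"
    then show "?f i \<in> J"
      using J.I_r_closed[OF J] twist_closed \<beta>K K_closed by simp
  qed
  ultimately have "?f r \<oplus> ?rest \<oplus> \<ominus> ?rest \<in> J"
    using J.a_closed J.a_inv_closed by blast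
  moreover have "?rest \<in> carrier R" using rest J.a_Hcarr by blast
  ultimately have fr: "?f r \<in> J" using f[OF r(1)] by (simp add: a_assoc r_neg)
  \<comment> \<open>The inverse lies in \<open>K\<close> itself, so it can be twisted along with
    \<open>\<beta> r\<close>, and its twist cancels the twisted coefficient from the right.\<close>
  obtain c where c: "c \<in> K" "\<beta> r \<otimes> c = \<one>" using r(2) by (auto simp: Units_def)
  have "?f r \<otimes> twist (r + j) c = u [^] (r + j) \<otimes> s \<otimes> (twist (r + j) (\<beta> r) \<otimes> twist (r + j) c)"
    using twist_closed \<beta>K[OF r(1)] c s by (simp add: m_assoc pow_closed K_closed)
  also have "\<dots> = u [^] (r + j) \<otimes> s"
    using s by (simp add: c(2) twist_one pow_closed K_closed flip: twist_mult[OF \<beta>K[OF r(1)] c(1)])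
  finally show ?thesis
    using J.I_r_closed[OF fr] twist_closed[OF c(1)] K_closed by metis
qed

text \<open>A window of \<open>q - p\<close> consecutive exponents is one short of the number of
  terms of \<alpha>. It therefore determines membership at the next exponent on either side: the
  unit \<open>\<beta> q\<close> yields the one above, the unit \<open>\<beta> p\<close> the one
  below. Shifting the window reaches all integers.\<close>

lemma exists_annihilator_of_powers:
  assumes J: "right_ideal J R" and s0: "s0 \<in> K" "s0 \<in> J" "s0 \<noteq> \<zero>"
    and "\<alpha> \<in> J" "unitary_wrt R K u \<alpha>"
  shows "\<exists>s\<in>K - {\<zero>}. \<forall>i::int. u [^] i \<otimes> s \<in> J"
proof -
  obtain p q :: int and \<beta> where pq: "p \<le> q" and \<beta>: "\<beta> \<in> {p..q} \<rightarrow> K"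
    and \<alpha>: "(\<Oplus>i\<in>{p..q}. \<beta> i \<otimes> u [^] i) \<in> J"
    and units: "\<beta> p \<in> Units (R\<lparr>carrier := K\<rparr>)" "\<beta> q \<in> Units (R\<lparr>carrier := K\<rparr>)"
    using assms(5,6) unfolding unitary_wrt_def by blast
  obtain s where s: "s \<in> K" "s \<noteq> \<zero>" and base: "\<forall>i\<in>{p..<q}. u [^] i \<otimes> s \<in> J"
    using exists_annihilator_on_finite[OF J s0, of "{p..<q}"] by blast
  note ext = extend_window[OF J \<beta> \<alpha> _ _ s(1)]
  have window: "\<forall>i\<in>{p..<q}. u [^] (i + j) \<otimes> s \<in> J" for j
  proof (induction j rule: int_induct[where k = 0])
    case base
    show ?case using \<open>\<forall>i\<in>{p..<q}. u [^] i \<otimes> s \<in> J\<close> by simp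
  next
    case (step1 j)
    \<comment> \<open>The window shifted by \<open>j\<close> covers \<open>p + j\<close> to
      \<open>q + j - 1\<close>, so only the term of index \<open>q\<close> is new.\<close>
    have top: "u [^] (q + j) \<otimes> s \<in> J"
      by (rule ext[OF _ units(2)]) (use pq step1 in auto)
    show ?case
    proof
      fix i assume i: "i \<in> {p..<q}"
      show "u [^] (i + (j + 1)) \<otimes> s \<in> J"
      proof (cases "i + 1 = q")
        case True
        then have "i + (j + 1) = q + j" by simp
        then show ?thesis using top by (simp only:)
      next
        case False
        then have "i + 1 \<in> {p..<q}" using i by simp
        then have "u [^] (i + 1 + j) \<otimes> s \<in> J" using step1 by blast
        then show ?thesis by (simp add: ac_simps)
      qed
    qed
  next
    case (step2 j)
    \<comment> \<open>Relative to the shift \<open>j - 1\<close>, the known exponents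
      \<open>p + j\<close> to \<open>q + j - 1\<close> belong to the indices \<open>p + 1\<close> to
      \<open>q\<close>, and only index \<open>p\<close> is missing.\<close>
    have bottom: "u [^] (p + (j - 1)) \<otimes> s \<in> J"
    proof (rule ext[OF _ units(1)])
      fix i assume "i \<in> {p..q}" "i \<noteq> p"
      then have "i - 1 \<in> {p..<q}" by simp
      then have "u [^] (i - 1 + j) \<otimes> s \<in> J" using step2 by blast
      then show "u [^] (i + (j - 1)) \<otimes> s \<in> J" by (simp add: algebra_simps)
    qed (use pq in auto)
    show ?case
    proof
      fix i assume i: "i \<in> {p..<q}"
      show "u [^] (i + (j - 1)) \<otimes> s \<in> J"
      proof (cases "i = p")
        case True
        then show ?thesis using bottom by simp
      next
        case False
        then have "i - 1 \<in> {p..<q}" using i by simp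
        then have "u [^] (i - 1 + j) \<otimes> s \<in> J" using step2 by blast
        then show ?thesis by (simp add: algebra_simps)
      qed
    qed
  qed
  \<comment> \<open>Every \<open>k\<close> sits just above the window shifted by
    \<open>k - q\<close>. Extending once more, rather than finding \<open>k\<close> inside a window,
    also covers \<open>p = q\<close>, where the windows are empty.\<close>
  have "u [^] k \<otimes> s \<in> J" for k :: int
  proof -
    have "u [^] (q + (k - q)) \<otimes> s \<in> J"
      by (rule ext[OF _ units(2)]) (use pq window in auto)
    then show ?thesis by simp
  qed
  then show ?thesis using s by blast
qed

end

section \<open>Twisted group algebras\<close>

text \<open>The coset of \<open>a\<close> is a power of the generating coset, hence the coset of a
  power of \<open>t\<close>. The power is written first to match products of a power of the basis
  element of \<open>t\<close> with an element of \<open>F * B\<close>.\<close>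

lemma (in comm_group) cyclic_quotient_cover:
  assumes "subgroup B G" and t: "t \<in> carrier G"
    and gen: "carrier (G Mod B) = generate (G Mod B) {B #> t}" and a: "a \<in> carrier G"
  shows "\<exists>b\<in>B. \<exists>i::int. a = t [^] i \<otimes> b"
proof -
  interpret normal B G using assms(1) by (rule subgroup_imp_normal)
  interpret Q: group "G Mod B" by (rule factorgroup_is_group)
  have tB: "B #> t \<in> carrier (G Mod B)" using t by (simp add: carrier_FactGroup)
  have "B #> a \<in> carrier (G Mod B)" using a by (simp add: carrier_FactGroup)
  then obtain i :: int where "B #> a = (B #> t) [^]\<^bsub>G Mod B\<^esub> i"
    unfolding gen Q.generate_pow[OF tB] by blast
  then have "B #> a = B #> (t [^] i)" by (simp add: FactGroup_int_pow[OF t])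
  then have "a \<in> B #> (t [^] i)" using rcos_self[OF a assms(1)] by simp
  then obtain b where b: "b \<in> B" "a = b \<otimes> t [^] i" by (auto simp: r_coset_def)
  then have "a = t [^] i \<otimes> b" using t subset by (simp add: m_comm subsetD)
  then show ?thesis using b by blast
qed

lemma tga_mult:
  "(x \<otimes>\<^bsub>twisted_group_algebra F A lam\<^esub> y) c =
    (\<Oplus>\<^bsub>F\<^esub>a\<in>supp F x. \<Oplus>\<^bsub>F\<^esub>b\<in>{b \<in> supp F y. a \<otimes>\<^bsub>A\<^esub> b = c}. lam a b \<otimes>\<^bsub>F\<^esub> (x a \<otimes>\<^bsub>F\<^esub> y b))"
  by (simp add: twisted_group_algebra_def)

lemma tga_add: "(x \<oplus>\<^bsub>twisted_group_algebra F A lam\<^esub> y) c = x c \<oplus>\<^bsub>F\<^esub> y c"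
  and tga_zero: "\<zero>\<^bsub>twisted_group_algebra F A lam\<^esub> c = \<zero>\<^bsub>F\<^esub>"
  and tga_one: "\<one>\<^bsub>twisted_group_algebra F A lam\<^esub> c =
    inv\<^bsub>F\<^esub> (lam \<one>\<^bsub>A\<^esub> \<one>\<^bsub>A\<^esub>) \<otimes>\<^bsub>F\<^esub> tga_basis F \<one>\<^bsub>A\<^esub> c"
  by (simp_all add: twisted_group_algebra_def)

lemma not_in_supp: "a \<notin> supp F x \<Longrightarrow> x a = \<zero>\<^bsub>F\<^esub>"
  by (simp add: supp_def)

section \<open>Ring structure of the twisted group algebra\<close>

locale tga = F: field F + A: group A
  for F :: "('f, 'm) ring_scheme" and A :: "('a, 'n) monoid_scheme" +
  fixes lam :: "'a \<Rightarrow> 'a \<Rightarrow> 'f"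
  assumes cocycle: "two_cocycle F A lam"
begin

abbreviation R :: "('a \<Rightarrow> 'f) ring" where "R \<equiv> twisted_group_algebra F A lam"

lemma mult_inv_mult [simp]:
    "\<lbrakk>a \<in> carrier A; c \<in> carrier A\<rbrakk> \<Longrightarrow> a \<otimes>\<^bsub>A\<^esub> (inv\<^bsub>A\<^esub> a \<otimes>\<^bsub>A\<^esub> c) = c"
  and inv_mult_mult [simp]:
    "\<lbrakk>a \<in> carrier A; c \<in> carrier A\<rbrakk> \<Longrightarrow> inv\<^bsub>A\<^esub> a \<otimes>\<^bsub>A\<^esub> (a \<otimes>\<^bsub>A\<^esub> c) = c"
  by (simp_all flip: A.m_assoc)

lemma mult_eq_iff:
  "\<lbrakk>a \<in> carrier A; b \<in> carrier A; c \<in> carrier A\<rbrakk> \<Longrightarrow> a \<otimes>\<^bsub>A\<^esub> b = c \<longleftrightarrow> b = inv\<^bsub>A\<^esub> a \<otimes>\<^bsub>A\<^esub> c"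
  by (metis inv_mult_mult mult_inv_mult)

text \<open>A scalar is carried along because products and inverses of basis elements are only
  scalar multiples of basis elements.\<close>

definition monomial :: "'f \<Rightarrow> 'a \<Rightarrow> 'a \<Rightarrow> 'f" where
  "monomial k g = (\<lambda>x. if x = g then k else \<zero>\<^bsub>F\<^esub>)"

lemma lam_closed [simp]: "\<lbrakk>a \<in> carrier A; b \<in> carrier A\<rbrakk> \<Longrightarrow> lam a b \<in> carrier F"
  and lam_nonzero [simp]: "\<lbrakk>a \<in> carrier A; b \<in> carrier A\<rbrakk> \<Longrightarrow> lam a b \<noteq> \<zero>\<^bsub>F\<^esub>"
  using cocycle by (auto simp: two_cocycle_def)

lemma lam_cocycle:
  "\<lbrakk>a \<in> carrier A; b \<in> carrier A; c \<in> carrier A\<rbrakk>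
    \<Longrightarrow> lam a b \<otimes>\<^bsub>F\<^esub> lam (a \<otimes>\<^bsub>A\<^esub> b) c = lam b c \<otimes>\<^bsub>F\<^esub> lam a (b \<otimes>\<^bsub>A\<^esub> c)"
  using cocycle by (auto simp: two_cocycle_def)

text \<open>The cocycle condition at \<open>1, 1, a\<close>, after cancelling one factor
  \<open>lam 1 a\<close>; the right-hand version uses \<open>a, 1, 1\<close>.\<close>

lemma lam_one_left:
  assumes "a \<in> carrier A" shows "lam \<one>\<^bsub>A\<^esub> a = lam \<one>\<^bsub>A\<^esub> \<one>\<^bsub>A\<^esub>"
proof -
  have "lam \<one>\<^bsub>A\<^esub> a \<otimes>\<^bsub>F\<^esub> lam \<one>\<^bsub>A\<^esub> \<one>\<^bsub>A\<^esub> = lam \<one>\<^bsub>A\<^esub> a \<otimes>\<^bsub>F\<^esub> lam \<one>\<^bsub>A\<^esub> a"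
    using lam_cocycle[of "\<one>\<^bsub>A\<^esub>" "\<one>\<^bsub>A\<^esub>" a] assms by (simp add: F.m_comm)
  then show ?thesis using assms F.m_lcancel by (metis A.one_closed lam_closed lam_nonzero)
qed

lemma lam_one_right:
  assumes "a \<in> carrier A" shows "lam a \<one>\<^bsub>A\<^esub> = lam \<one>\<^bsub>A\<^esub> \<one>\<^bsub>A\<^esub>"
proof -
  have "lam a \<one>\<^bsub>A\<^esub> \<otimes>\<^bsub>F\<^esub> lam a \<one>\<^bsub>A\<^esub> = lam a \<one>\<^bsub>A\<^esub> \<otimes>\<^bsub>F\<^esub> lam \<one>\<^bsub>A\<^esub> \<one>\<^bsub>A\<^esub>"
    using lam_cocycle[of a "\<one>\<^bsub>A\<^esub>" "\<one>\<^bsub>A\<^esub>"] assms by (simp add: F.m_comm)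
  then show ?thesis using assms F.m_lcancel by (metis A.one_closed lam_closed lam_nonzero)
qed

lemma coeff_closed: "x \<in> carrier R \<Longrightarrow> x a \<in> carrier F"
  and supp_subset: "x \<in> carrier R \<Longrightarrow> supp F x \<subseteq> carrier A"
  and finite_supp [simp]: "x \<in> carrier R \<Longrightarrow> finite (supp F x)"
  by (auto simp: twisted_group_algebra_def)

lemma coeff_outside: "\<lbrakk>x \<in> carrier R; a \<notin> carrier A\<rbrakk> \<Longrightarrow> x a = \<zero>\<^bsub>F\<^esub>"
  using supp_subset by (auto simp: supp_def)

lemma carrierI:
  "\<lbrakk>\<And>a. x a \<in> carrier F; finite S; S \<subseteq> carrier A; \<And>a. a \<notin> S \<Longrightarrow> x a = \<zero>\<^bsub>F\<^esub>\<rbrakk> \<Longrightarrow> x \<in> carrier R"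
  unfolding twisted_group_algebra_def supp_def
  by (auto intro: finite_subset[of _ S])

lemma zero_closed: "\<zero>\<^bsub>R\<^esub> \<in> carrier R"
  by (rule carrierI[of _ "{}"]) (auto simp: tga_zero)

lemma add_closed: "\<lbrakk>x \<in> carrier R; y \<in> carrier R\<rbrakk> \<Longrightarrow> x \<oplus>\<^bsub>R\<^esub> y \<in> carrier R"
  by (rule carrierI[of _ "supp F x \<union> supp F y"]) (use supp_subset in \<open>auto simp: not_in_supp[of _ F x] not_in_supp[of _ F y] coeff_closed tga_add tga_zero\<close>)

lemma monomial_apply: "monomial k g h = (if h = g then k else \<zero>\<^bsub>F\<^esub>)"
  by (simp add: monomial_def)

lemma monomial_closed [simp]: "\<lbrakk>k \<in> carrier F; g \<in> carrier A\<rbrakk> \<Longrightarrow> monomial k g \<in> carrier R"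
  by (rule carrierI[of _ "{g}"]) (auto simp: monomial_apply)

lemma one_eq_monomial: "\<one>\<^bsub>R\<^esub> = monomial (inv\<^bsub>F\<^esub> lam \<one>\<^bsub>A\<^esub> \<one>\<^bsub>A\<^esub>) \<one>\<^bsub>A\<^esub>"
  by (auto intro!: ext simp: tga_one monomial_apply tga_basis_def F.field_Units)

lemma tga_basis_eq_monomial: "tga_basis F g = monomial \<one>\<^bsub>F\<^esub> g"
  by (simp add: tga_basis_def monomial_def)

lemma abelian_group_R: "abelian_group R"
proof (rule abelian_groupI)
  fix x assume x: "x \<in> carrier R"
  have "(\<lambda>c. \<ominus>\<^bsub>F\<^esub> x c) \<in> carrier R"
    by (rule carrierI[of _ "supp F x"]) (use supp_subset x in \<open>auto simp: not_in_supp[of _ F x] coeff_closed\<close>)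
  moreover have "(\<lambda>c. \<ominus>\<^bsub>F\<^esub> x c) \<oplus>\<^bsub>R\<^esub> x = \<zero>\<^bsub>R\<^esub>"
    by (auto intro!: ext simp: tga_add tga_zero F.l_neg coeff_closed x)
  ultimately show "\<exists>y\<in>carrier R. y \<oplus>\<^bsub>R\<^esub> x = \<zero>\<^bsub>R\<^esub>" by blast
qed (auto intro!: ext simp: tga_add tga_zero zero_closed add_closed F.a_ac coeff_closed)

text \<open>For given \<open>a\<close> the equation \<open>a b = c\<close> has the single solution
  \<open>a^-1 c\<close>, so the inner sum has at most one term. Any finite \<open>S\<close> around
  the support of \<open>x\<close> is allowed, so that products with different left factors can be
  compared over one index set.\<close>

lemma mult_coeff:
  assumes x: "x \<in> carrier R" and y: "y \<in> carrier R" and c: "c \<in> carrier A"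
    and S: "finite S" "supp F x \<subseteq> S" "S \<subseteq> carrier A"
  shows "(x \<otimes>\<^bsub>R\<^esub> y) c =
    (\<Oplus>\<^bsub>F\<^esub>a\<in>S. lam a (inv\<^bsub>A\<^esub> a \<otimes>\<^bsub>A\<^esub> c) \<otimes>\<^bsub>F\<^esub> (x a \<otimes>\<^bsub>F\<^esub> y (inv\<^bsub>A\<^esub> a \<otimes>\<^bsub>A\<^esub> c)))"
    (is "_ = (\<Oplus>\<^bsub>F\<^esub>a\<in>S. ?h a)")
proof -
  have h: "?h a \<in> carrier F" if "a \<in> carrier A" for a
    using that c by (simp add: coeff_closed x y)
  have inner: "(\<Oplus>\<^bsub>F\<^esub>b\<in>{b \<in> supp F y. a \<otimes>\<^bsub>A\<^esub> b = c}. lam a b \<otimes>\<^bsub>F\<^esub> (x a \<otimes>\<^bsub>F\<^esub> y b)) = ?h a"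
    if a: "a \<in> carrier A" for a
  proof -
    let ?b = "inv\<^bsub>A\<^esub> a \<otimes>\<^bsub>A\<^esub> c"
    have eq: "{b \<in> supp F y. a \<otimes>\<^bsub>A\<^esub> b = c} = supp F y \<inter> {?b}"
    proof (rule Set.set_eqI)
      fix b
      show "b \<in> {b \<in> supp F y. a \<otimes>\<^bsub>A\<^esub> b = c} \<longleftrightarrow> b \<in> supp F y \<inter> {?b}"
      proof (cases "b \<in> supp F y")
        case True
        then have "b \<in> carrier A" using supp_subset[OF y] by (rule rev_subsetD)
        then show ?thesis using True a c by (simp add: mult_eq_iff)
      qed simp
    qed
    show ?thesis
    proof (cases "?b \<in> supp F y")
      case True
      then have "supp F y \<inter> {?b} = {?b}" by blast
      then show ?thesis unfolding eq using a c by (simp add: coeff_closed x y)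
    next
      case False
      then have "supp F y \<inter> {?b} = {}" by blast
      moreover have "y ?b = \<zero>\<^bsub>F\<^esub>" by (rule not_in_supp[OF False])
      ultimately show ?thesis unfolding eq using a c by (simp add: coeff_closed x)
    qed
  qed
  have "(x \<otimes>\<^bsub>R\<^esub> y) c = (\<Oplus>\<^bsub>F\<^esub>a\<in>supp F x. \<Oplus>\<^bsub>F\<^esub>b\<in>{b \<in> supp F y. a \<otimes>\<^bsub>A\<^esub> b = c}. lam a b \<otimes>\<^bsub>F\<^esub> (x a \<otimes>\<^bsub>F\<^esub> y b))"
    by (rule tga_mult)
  also have "\<dots> = (\<Oplus>\<^bsub>F\<^esub>a\<in>supp F x. ?h a)"
    by (rule F.finsum_cong') (use h inner supp_subset[OF x] in auto)
  also have "\<dots> = (\<Oplus>\<^bsub>F\<^esub>a\<in>S. ?h a)"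
    by (rule F.add.finprod_mono_neutral_cong_left) (use S c in \<open>auto simp: not_in_supp[of _ F x] coeff_closed x y\<close>)
  finally show ?thesis .
qed

lemma mult_coeff_outside:
  assumes x: "x \<in> carrier R" and y: "y \<in> carrier R" and c: "c \<notin> carrier A"
  shows "(x \<otimes>\<^bsub>R\<^esub> y) c = \<zero>\<^bsub>F\<^esub>"
proof -
  have e: "{b \<in> supp F y. a \<otimes>\<^bsub>A\<^esub> b = c} = {}" if "a \<in> supp F x" for a
    using that c supp_subset[OF x] supp_subset[OF y] by auto
  have "(x \<otimes>\<^bsub>R\<^esub> y) c = (\<Oplus>\<^bsub>F\<^esub>a\<in>supp F x. \<Oplus>\<^bsub>F\<^esub>b\<in>{b \<in> supp F y. a \<otimes>\<^bsub>A\<^esub> b = c}. lam a b \<otimes>\<^bsub>F\<^esub> (x a \<otimes>\<^bsub>F\<^esub> y b))"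
    by (rule tga_mult)
  also have "\<dots> = (\<Oplus>\<^bsub>F\<^esub>a\<in>supp F x. \<zero>\<^bsub>F\<^esub>)"
    by (rule F.finsum_cong') (auto simp only: e F.finsum_empty F.zero_closed Pi_I)
  finally show ?thesis by simp
qed

lemma mult_supp:
  assumes x: "x \<in> carrier R" and y: "y \<in> carrier R"
  shows "supp F (x \<otimes>\<^bsub>R\<^esub> y) \<subseteq> (\<lambda>(a, b). a \<otimes>\<^bsub>A\<^esub> b) ` (supp F x \<times> supp F y)" (is "_ \<subseteq> ?P")
proof
  fix c assume "c \<in> supp F (x \<otimes>\<^bsub>R\<^esub> y)"
  then have nz: "(x \<otimes>\<^bsub>R\<^esub> y) c \<noteq> \<zero>\<^bsub>F\<^esub>" by (simp add: supp_def)
  then have c: "c \<in> carrier A" using mult_coeff_outside[OF x y] by blast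
  show "c \<in> ?P"
  proof (rule ccontr)
    assume "c \<notin> ?P"
    then have z: "y (inv\<^bsub>A\<^esub> a \<otimes>\<^bsub>A\<^esub> c) = \<zero>\<^bsub>F\<^esub>" if "a \<in> supp F x" for a
      using that c supp_subset[OF x]
      by (force simp: supp_def image_iff)
    have "(x \<otimes>\<^bsub>R\<^esub> y) c = (\<Oplus>\<^bsub>F\<^esub>a\<in>supp F x. \<zero>\<^bsub>F\<^esub>)"
      unfolding mult_coeff[OF x y c finite_supp[OF x] subset_refl supp_subset[OF x]]
      by (rule F.finsum_cong') (use c supp_subset[OF x] in \<open>auto simp: z subset_iff coeff_closed x\<close>)
    then show False using nz by simp
  qed
qed

lemma mult_closed:
  assumes x: "x \<in> carrier R" and y: "y \<in> carrier R"
  shows "x \<otimes>\<^bsub>R\<^esub> y \<in> carrier R"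
proof (rule carrierI[of _ "(\<lambda>(a, b). a \<otimes>\<^bsub>A\<^esub> b) ` (supp F x \<times> supp F y)"])
  fix c show "(x \<otimes>\<^bsub>R\<^esub> y) c \<in> carrier F"
  proof (cases "c \<in> carrier A")
    case True
    show ?thesis
      unfolding mult_coeff[OF x y True finite_supp[OF x] subset_refl supp_subset[OF x]]
      by (rule F.finsum_closed) (use True supp_subset[OF x] in \<open>auto simp: coeff_closed x y\<close>)
  qed (simp add: mult_coeff_outside x y)
  show "(x \<otimes>\<^bsub>R\<^esub> y) c = \<zero>\<^bsub>F\<^esub>" if "c \<notin> (\<lambda>(a, b). a \<otimes>\<^bsub>A\<^esub> b) ` (supp F x \<times> supp F y)"
    using mult_supp[OF x y] that by (auto simp: supp_def)
qed (use x y supp_subset in auto)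

lemma l_distr:
  assumes x: "x \<in> carrier R" and y: "y \<in> carrier R" and z: "z \<in> carrier R"
  shows "(x \<oplus>\<^bsub>R\<^esub> y) \<otimes>\<^bsub>R\<^esub> z = x \<otimes>\<^bsub>R\<^esub> z \<oplus>\<^bsub>R\<^esub> y \<otimes>\<^bsub>R\<^esub> z"
proof
  fix c
  \<comment> \<open>Cancellation may make the support of the sum smaller than this union, so all
    three products are expanded over the union.\<close>
  let ?S = "supp F x \<union> supp F y"
  let ?h = "\<lambda>x a. lam a (inv\<^bsub>A\<^esub> a \<otimes>\<^bsub>A\<^esub> c) \<otimes>\<^bsub>F\<^esub> (x a \<otimes>\<^bsub>F\<^esub> z (inv\<^bsub>A\<^esub> a \<otimes>\<^bsub>A\<^esub> c))"
  have S: "finite ?S" "?S \<subseteq> carrier A" using x y supp_subset by auto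
  have sub: "supp F x \<subseteq> ?S" "supp F y \<subseteq> ?S" "supp F (x \<oplus>\<^bsub>R\<^esub> y) \<subseteq> ?S" by (auto simp: supp_def tga_add)
  show "((x \<oplus>\<^bsub>R\<^esub> y) \<otimes>\<^bsub>R\<^esub> z) c = (x \<otimes>\<^bsub>R\<^esub> z \<oplus>\<^bsub>R\<^esub> y \<otimes>\<^bsub>R\<^esub> z) c"
  proof (cases "c \<in> carrier A")
    case True
    have h: "?h x a \<in> carrier F" "?h y a \<in> carrier F" "?h (x \<oplus>\<^bsub>R\<^esub> y) a = ?h x a \<oplus>\<^bsub>F\<^esub> ?h y a" if "a \<in> ?S" for a
    proof -
      have a: "a \<in> carrier A" using that S(2) by blast
      then show "?h x a \<in> carrier F" "?h y a \<in> carrier F" "?h (x \<oplus>\<^bsub>R\<^esub> y) a = ?h x a \<oplus>\<^bsub>F\<^esub> ?h y a"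
        using True by (simp_all add: coeff_closed tga_add x y z F.l_distr F.r_distr)
    qed
    have "(\<Oplus>\<^bsub>F\<^esub>a\<in>?S. ?h (x \<oplus>\<^bsub>R\<^esub> y) a) = (\<Oplus>\<^bsub>F\<^esub>a\<in>?S. ?h x a \<oplus>\<^bsub>F\<^esub> ?h y a)"
      by (rule F.finsum_cong') (use h in blast)+
    also have "\<dots> = (\<Oplus>\<^bsub>F\<^esub>a\<in>?S. ?h x a) \<oplus>\<^bsub>F\<^esub> (\<Oplus>\<^bsub>F\<^esub>a\<in>?S. ?h y a)"
      by (rule F.finsum_addf) (use h in blast)+
    finally show ?thesis
      unfolding tga_add mult_coeff[OF add_closed[OF x y] z True S(1) sub(3) S(2)]
        mult_coeff[OF x z True S(1) sub(1) S(2)] mult_coeff[OF y z True S(1) sub(2) S(2)] .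
  qed (simp add: mult_coeff_outside x y z add_closed tga_add)
qed

lemma r_distr:
  assumes x: "x \<in> carrier R" and y: "y \<in> carrier R" and z: "z \<in> carrier R"
  shows "z \<otimes>\<^bsub>R\<^esub> (x \<oplus>\<^bsub>R\<^esub> y) = z \<otimes>\<^bsub>R\<^esub> x \<oplus>\<^bsub>R\<^esub> z \<otimes>\<^bsub>R\<^esub> y"
proof
  fix c
  let ?S = "supp F z"
  let ?h = "\<lambda>x a. lam a (inv\<^bsub>A\<^esub> a \<otimes>\<^bsub>A\<^esub> c) \<otimes>\<^bsub>F\<^esub> (z a \<otimes>\<^bsub>F\<^esub> x (inv\<^bsub>A\<^esub> a \<otimes>\<^bsub>A\<^esub> c))"
  have S: "finite ?S" "?S \<subseteq> ?S" "?S \<subseteq> carrier A" using z supp_subset by auto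
  show "(z \<otimes>\<^bsub>R\<^esub> (x \<oplus>\<^bsub>R\<^esub> y)) c = (z \<otimes>\<^bsub>R\<^esub> x \<oplus>\<^bsub>R\<^esub> z \<otimes>\<^bsub>R\<^esub> y) c"
  proof (cases "c \<in> carrier A")
    case True
    have h: "?h x a \<in> carrier F" "?h y a \<in> carrier F" "?h (x \<oplus>\<^bsub>R\<^esub> y) a = ?h x a \<oplus>\<^bsub>F\<^esub> ?h y a" if "a \<in> ?S" for a
    proof -
      have a: "a \<in> carrier A" using that S(3) by blast
      then show "?h x a \<in> carrier F" "?h y a \<in> carrier F" "?h (x \<oplus>\<^bsub>R\<^esub> y) a = ?h x a \<oplus>\<^bsub>F\<^esub> ?h y a"
        using True by (simp_all add: coeff_closed tga_add x y z F.l_distr F.r_distr)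
    qed
    have "(\<Oplus>\<^bsub>F\<^esub>a\<in>?S. ?h (x \<oplus>\<^bsub>R\<^esub> y) a) = (\<Oplus>\<^bsub>F\<^esub>a\<in>?S. ?h x a \<oplus>\<^bsub>F\<^esub> ?h y a)"
      by (rule F.finsum_cong') (use h in blast)+
    also have "\<dots> = (\<Oplus>\<^bsub>F\<^esub>a\<in>?S. ?h x a) \<oplus>\<^bsub>F\<^esub> (\<Oplus>\<^bsub>F\<^esub>a\<in>?S. ?h y a)"
      by (rule F.finsum_addf) (use h in blast)+
    finally show ?thesis
      unfolding tga_add mult_coeff[OF z add_closed[OF x y] True S]
        mult_coeff[OF z x True S] mult_coeff[OF z y True S] .
  qed (simp add: mult_coeff_outside x y z add_closed tga_add)
qed

section \<open>Monomials, associativity and the identity\<close>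

lemma monomial_mult_coeff:
  assumes "k \<in> carrier F" "g \<in> carrier A" "x \<in> carrier R" "d \<in> carrier A"
  shows "(monomial k g \<otimes>\<^bsub>R\<^esub> x) (g \<otimes>\<^bsub>A\<^esub> d) = lam g d \<otimes>\<^bsub>F\<^esub> (k \<otimes>\<^bsub>F\<^esub> x d)"
proof -
  have "supp F (monomial k g) \<subseteq> {g}" by (auto simp: supp_def monomial_apply)
  then show ?thesis
    by (subst mult_coeff[of _ _ _ "{g}"]) (use assms in \<open>auto simp: monomial_apply coeff_closed\<close>)
qed

text \<open>The sum runs over the left factor, and only the index \<open>d\<close> survives. As
  \<open>d\<close> need not lie in the support of \<open>x\<close>, it is inserted into the index
  set.\<close>

lemma mult_monomial_coeff:
  assumes k: "k \<in> carrier F" and g: "g \<in> carrier A" and x: "x \<in> carrier R" and d: "d \<in> carrier A"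
  shows "(x \<otimes>\<^bsub>R\<^esub> monomial k g) (d \<otimes>\<^bsub>A\<^esub> g) = lam d g \<otimes>\<^bsub>F\<^esub> (x d \<otimes>\<^bsub>F\<^esub> k)"
proof -
  let ?S = "insert d (supp F x)"
  have SA: "a \<in> carrier A" if "a \<in> ?S" for a using that d supp_subset[OF x] by auto
  have eq: "inv\<^bsub>A\<^esub> a \<otimes>\<^bsub>A\<^esub> (d \<otimes>\<^bsub>A\<^esub> g) = g \<longleftrightarrow> d = a" if "a \<in> carrier A" for a
    using that d g
    by (metis A.inv_closed A.inv_solve_left A.m_closed A.r_cancel)
  have "(x \<otimes>\<^bsub>R\<^esub> monomial k g) (d \<otimes>\<^bsub>A\<^esub> g) =
     (\<Oplus>\<^bsub>F\<^esub>a\<in>?S. lam a (inv\<^bsub>A\<^esub> a \<otimes>\<^bsub>A\<^esub> (d \<otimes>\<^bsub>A\<^esub> g)) \<otimes>\<^bsub>F\<^esub> (x a \<otimes>\<^bsub>F\<^esub> monomial k g (inv\<^bsub>A\<^esub> a \<otimes>\<^bsub>A\<^esub> (d \<otimes>\<^bsub>A\<^esub> g))))"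
    by (rule mult_coeff) (use assms SA in \<open>auto simp: coeff_closed\<close>)
  also have "\<dots> = (\<Oplus>\<^bsub>F\<^esub>a\<in>?S. if d = a then lam a g \<otimes>\<^bsub>F\<^esub> (x a \<otimes>\<^bsub>F\<^esub> k) else \<zero>\<^bsub>F\<^esub>)"
  proof (rule F.finsum_cong')
    fix a assume "a \<in> ?S"
    then have a: "a \<in> carrier A" by (rule SA)
    show "lam a (inv\<^bsub>A\<^esub> a \<otimes>\<^bsub>A\<^esub> (d \<otimes>\<^bsub>A\<^esub> g)) \<otimes>\<^bsub>F\<^esub> (x a \<otimes>\<^bsub>F\<^esub> monomial k g (inv\<^bsub>A\<^esub> a \<otimes>\<^bsub>A\<^esub> (d \<otimes>\<^bsub>A\<^esub> g)))
      = (if d = a then lam a g \<otimes>\<^bsub>F\<^esub> (x a \<otimes>\<^bsub>F\<^esub> k) else \<zero>\<^bsub>F\<^esub>)"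
      using a eq[OF a] d g k by (auto simp: monomial_apply coeff_closed x)
  qed (use assms SA in \<open>auto simp: coeff_closed\<close>)
  also have "\<dots> = lam d g \<otimes>\<^bsub>F\<^esub> (x d \<otimes>\<^bsub>F\<^esub> k)"
    by (rule F.add.finprod_singleton) (use assms SA in \<open>auto simp: coeff_closed\<close>)
  finally show ?thesis .
qed

lemma monomial_mult_monomial:
  assumes "k \<in> carrier F" "l \<in> carrier F" "g \<in> carrier A" "h \<in> carrier A"
  shows "monomial k g \<otimes>\<^bsub>R\<^esub> monomial l h = monomial (lam g h \<otimes>\<^bsub>F\<^esub> (k \<otimes>\<^bsub>F\<^esub> l)) (g \<otimes>\<^bsub>A\<^esub> h)"
proof
  fix c
  show "(monomial k g \<otimes>\<^bsub>R\<^esub> monomial l h) c = monomial (lam g h \<otimes>\<^bsub>F\<^esub> (k \<otimes>\<^bsub>F\<^esub> l)) (g \<otimes>\<^bsub>A\<^esub> h) c"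
  proof (cases "c \<in> carrier A")
    case True
    define d where "d = inv\<^bsub>A\<^esub> g \<otimes>\<^bsub>A\<^esub> c"
    have d: "d \<in> carrier A" "c = g \<otimes>\<^bsub>A\<^esub> d" using True assms by (auto simp: d_def)
    show ?thesis
      unfolding d(2) using assms d(1) by (subst monomial_mult_coeff) (auto simp: monomial_apply)
  qed (use assms in \<open>auto simp: mult_coeff_outside monomial_apply\<close>)
qed

text \<open>Induction on a finite set containing the support: splitting off one coefficient as a
  monomial leaves an element supported on the rest. Additive statements thus reduce to
  monomials.\<close>

lemma R_induct [consumes 1, case_names zero monomial add]:
  assumes "x \<in> carrier R"
    and zero: "P \<zero>\<^bsub>R\<^esub>"
    and monomial: "\<And>k g. \<lbrakk>k \<in> carrier F; g \<in> carrier A\<rbrakk> \<Longrightarrow> P (monomial k g)"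
    and add: "\<And>x y. \<lbrakk>x \<in> carrier R; y \<in> carrier R; P x; P y\<rbrakk> \<Longrightarrow> P (x \<oplus>\<^bsub>R\<^esub> y)"
  shows "P x"
proof -
  have "P x" if "finite S" "S \<subseteq> carrier A" "x \<in> carrier R" "supp F x \<subseteq> S" for S x
    using that
  proof (induction S arbitrary: x rule: finite_induct)
    case empty
    then have "x = \<zero>\<^bsub>R\<^esub>" by (auto simp: supp_def tga_zero)
    then show ?case using zero by (simp only:)
  next
    case (insert a S)
    let ?y = "x(a := \<zero>\<^bsub>F\<^esub>)"
    have a: "a \<in> carrier A" using insert.prems by blast
    have y0: "?y b = \<zero>\<^bsub>F\<^esub>" if "b \<notin> S" for b
      using that insert.prems(3) by (auto simp: supp_def)
    have y: "?y \<in> carrier R"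
      by (rule carrierI[of _ S])
        (use insert.hyps insert.prems y0 in \<open>auto simp: coeff_closed[OF insert.prems(2)]\<close>)
    have m: "monomial (x a) a \<in> carrier R"
      using a by (simp add: coeff_closed[OF insert.prems(2)])
    have "P ?y"
    proof (rule insert.IH[OF _ y])
      show "S \<subseteq> carrier A" using insert.prems(1) by blast
      show "supp F ?y \<subseteq> S" unfolding supp_def using y0 by blast
    qed
    moreover have "P (monomial (x a) a)"
      using a by (simp add: monomial coeff_closed[OF insert.prems(2)])
    ultimately have "P (?y \<oplus>\<^bsub>R\<^esub> monomial (x a) a)"
      using add y m by blast
    also have "?y \<oplus>\<^bsub>R\<^esub> monomial (x a) a = x"
      by (rule ext) (simp add: tga_add monomial_apply coeff_closed[OF insert.prems(2)])
    finally show ?case .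
  qed
  then show ?thesis using assms(1) supp_subset finite_supp by blast
qed

text \<open>Up to regrouping scalars, this is the cocycle condition at
  \<open>g, h, j\<close>.\<close>

lemma monomial_assoc:
  assumes "k \<in> carrier F" "l \<in> carrier F" "m \<in> carrier F" "g \<in> carrier A" "h \<in> carrier A" "j \<in> carrier A"
  shows "monomial k g \<otimes>\<^bsub>R\<^esub> monomial l h \<otimes>\<^bsub>R\<^esub> monomial m j =
    monomial k g \<otimes>\<^bsub>R\<^esub> (monomial l h \<otimes>\<^bsub>R\<^esub> monomial m j)"
proof -
  have "lam (g \<otimes>\<^bsub>A\<^esub> h) j \<otimes>\<^bsub>F\<^esub> (lam g h \<otimes>\<^bsub>F\<^esub> (k \<otimes>\<^bsub>F\<^esub> l) \<otimes>\<^bsub>F\<^esub> m) =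
     (lam g h \<otimes>\<^bsub>F\<^esub> lam (g \<otimes>\<^bsub>A\<^esub> h) j) \<otimes>\<^bsub>F\<^esub> (k \<otimes>\<^bsub>F\<^esub> l \<otimes>\<^bsub>F\<^esub> m)"
    using assms by (simp add: F.m_ac)
  also have "\<dots> = (lam h j \<otimes>\<^bsub>F\<^esub> lam g (h \<otimes>\<^bsub>A\<^esub> j)) \<otimes>\<^bsub>F\<^esub> (k \<otimes>\<^bsub>F\<^esub> l \<otimes>\<^bsub>F\<^esub> m)"
    using assms by (simp add: lam_cocycle)
  also have "\<dots> = lam g (h \<otimes>\<^bsub>A\<^esub> j) \<otimes>\<^bsub>F\<^esub> (k \<otimes>\<^bsub>F\<^esub> (lam h j \<otimes>\<^bsub>F\<^esub> (l \<otimes>\<^bsub>F\<^esub> m)))"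
    using assms by (simp add: F.m_ac)
  finally show ?thesis
    using assms by (simp add: monomial_mult_monomial A.m_assoc)
qed

lemma zero_mult: "x \<in> carrier R \<Longrightarrow> \<zero>\<^bsub>R\<^esub> \<otimes>\<^bsub>R\<^esub> x = \<zero>\<^bsub>R\<^esub>"
  and mult_zero: "x \<in> carrier R \<Longrightarrow> x \<otimes>\<^bsub>R\<^esub> \<zero>\<^bsub>R\<^esub> = \<zero>\<^bsub>R\<^esub>"
  using mult_supp[of "\<zero>\<^bsub>R\<^esub>" x] mult_supp[of x "\<zero>\<^bsub>R\<^esub>"] by (auto simp: zero_closed supp_def tga_zero)

text \<open>Both sides are additive in each of the three factors, so three nested inductions reduce
  the claim to monomials.\<close>

lemma mult_assoc:
  assumes x: "x \<in> carrier R" and y: "y \<in> carrier R" and z: "z \<in> carrier R"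
  shows "x \<otimes>\<^bsub>R\<^esub> y \<otimes>\<^bsub>R\<^esub> z = x \<otimes>\<^bsub>R\<^esub> (y \<otimes>\<^bsub>R\<^esub> z)"
  using x
proof (induction x rule: R_induct)
  case (monomial k g)
  note kg = monomial
  show ?case using y
  proof (induction y rule: R_induct)
    case (monomial l h)
    note lh = monomial
    show ?case using z
    proof (induction z rule: R_induct)
      case (monomial m j)
      then show ?case using kg lh by (simp add: monomial_assoc)
    qed (use kg lh in \<open>simp_all add: mult_zero zero_mult l_distr r_distr mult_closed zero_closed add_closed\<close>)
  qed (use kg z in \<open>simp_all add: mult_zero zero_mult l_distr r_distr mult_closed zero_closed add_closed\<close>)
qed (use y z in \<open>simp_all add: mult_zero zero_mult l_distr r_distr mult_closed zero_closed add_closed\<close>)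

lemma one_closed: "\<one>\<^bsub>R\<^esub> \<in> carrier R"
  unfolding one_eq_monomial by (simp add: F.field_Units)

lemma one_mult: "x \<in> carrier R \<Longrightarrow> \<one>\<^bsub>R\<^esub> \<otimes>\<^bsub>R\<^esub> x = x"
proof (induction x rule: R_induct)
  case (monomial k g)
  have "lam \<one>\<^bsub>A\<^esub> \<one>\<^bsub>A\<^esub> \<otimes>\<^bsub>F\<^esub> (inv\<^bsub>F\<^esub> lam \<one>\<^bsub>A\<^esub> \<one>\<^bsub>A\<^esub> \<otimes>\<^bsub>F\<^esub> k) =
    k \<otimes>\<^bsub>F\<^esub> (lam \<one>\<^bsub>A\<^esub> \<one>\<^bsub>A\<^esub> \<otimes>\<^bsub>F\<^esub> inv\<^bsub>F\<^esub> lam \<one>\<^bsub>A\<^esub> \<one>\<^bsub>A\<^esub>)"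
    using monomial by (simp add: F.m_ac F.field_Units del: F.Units_r_inv F.Units_l_inv)
  then show ?case
    using monomial
    by (simp add: one_eq_monomial monomial_mult_monomial F.field_Units lam_one_left[OF monomial(2)])
qed (simp_all add: mult_zero r_distr one_closed)

lemma mult_one: "x \<in> carrier R \<Longrightarrow> x \<otimes>\<^bsub>R\<^esub> \<one>\<^bsub>R\<^esub> = x"
proof (induction x rule: R_induct)
  case (monomial k g)
  have "lam \<one>\<^bsub>A\<^esub> \<one>\<^bsub>A\<^esub> \<otimes>\<^bsub>F\<^esub> (k \<otimes>\<^bsub>F\<^esub> inv\<^bsub>F\<^esub> lam \<one>\<^bsub>A\<^esub> \<one>\<^bsub>A\<^esub>) =
    k \<otimes>\<^bsub>F\<^esub> (lam \<one>\<^bsub>A\<^esub> \<one>\<^bsub>A\<^esub> \<otimes>\<^bsub>F\<^esub> inv\<^bsub>F\<^esub> lam \<one>\<^bsub>A\<^esub> \<one>\<^bsub>A\<^esub>)"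
    using monomial by (simp add: F.m_lcomm F.field_Units)
  then show ?case
    using monomial
    by (simp add: one_eq_monomial monomial_mult_monomial F.field_Units lam_one_right[OF monomial(2)])
qed (simp_all add: zero_mult l_distr one_closed)

theorem ring_R: "ring R"
  by (intro ringI abelian_group_R monoidI)
    (simp_all add: mult_closed one_closed mult_assoc one_mult mult_one l_distr r_distr)

interpretation R: ring R by (rule ring_R)

lemma neg_coeff:
  assumes x: "x \<in> carrier R" shows "(\<ominus>\<^bsub>R\<^esub> x) c = \<ominus>\<^bsub>F\<^esub> x c"
proof -
  have nx: "\<ominus>\<^bsub>R\<^esub> x \<in> carrier R" using x by simp
  have "(\<ominus>\<^bsub>R\<^esub> x) c \<oplus>\<^bsub>F\<^esub> x c = \<zero>\<^bsub>F\<^esub>"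
    using R.l_neg[OF x] tga_add[of F A lam "\<ominus>\<^bsub>R\<^esub> x" x c] by (simp only: tga_zero)
  then show ?thesis
    using F.minus_equality coeff_closed[OF x] coeff_closed[OF nx] by metis
qed

section \<open>Nonzero monomials as units\<close>

lemma inv_lam_one_Units: "inv\<^bsub>F\<^esub> lam \<one>\<^bsub>A\<^esub> \<one>\<^bsub>A\<^esub> \<in> Units F"
  by (rule F.Units_inv_Units) (simp add: F.field_Units)

lemma supp_monomial: "supp F (monomial k g) \<subseteq> {g}"
  by (auto simp: supp_def monomial_apply)

text \<open>The scalar \<open>?l\<close> solves \<open>lam g g^-1 * k * l = (lam 1 1)^-1\<close>,
  whose right-hand side is the coefficient of the identity element of the algebra.\<close>

lemma monomial_right_inverse:
  assumes k: "k \<in> carrier F" "k \<noteq> \<zero>\<^bsub>F\<^esub>" and g: "g \<in> carrier A"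
  obtains l where "l \<in> carrier F" "l \<noteq> \<zero>\<^bsub>F\<^esub>" "monomial k g \<otimes>\<^bsub>R\<^esub> monomial l (inv\<^bsub>A\<^esub> g) = \<one>\<^bsub>R\<^esub>"
proof
  let ?c = "inv\<^bsub>F\<^esub> lam \<one>\<^bsub>A\<^esub> \<one>\<^bsub>A\<^esub>" and ?m = "lam g (inv\<^bsub>A\<^esub> g) \<otimes>\<^bsub>F\<^esub> k"
  let ?l = "inv\<^bsub>F\<^esub> ?m \<otimes>\<^bsub>F\<^esub> ?c"
  have m: "?m \<in> Units F" using k g by (simp add: F.field_Units F.integral_iff)
  have c: "?c \<in> Units F" by (rule inv_lam_one_Units)
  have l: "?l \<in> Units F" using F.Units_m_closed[OF F.Units_inv_Units[OF m] c] .
  then show "?l \<in> carrier F" "?l \<noteq> \<zero>\<^bsub>F\<^esub>" by (auto simp: F.field_Units)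
  have "lam g (inv\<^bsub>A\<^esub> g) \<otimes>\<^bsub>F\<^esub> (k \<otimes>\<^bsub>F\<^esub> ?l) = ?m \<otimes>\<^bsub>F\<^esub> inv\<^bsub>F\<^esub> ?m \<otimes>\<^bsub>F\<^esub> ?c"
    using k(1) g F.Units_inv_closed[OF m] F.Units_closed[OF c]
    by (simp add: F.m_assoc del: F.Units_r_inv)
  also have "\<dots> = ?c" using m c by (simp add: F.Units_closed)
  finally show "monomial k g \<otimes>\<^bsub>R\<^esub> monomial ?l (inv\<^bsub>A\<^esub> g) = \<one>\<^bsub>R\<^esub>"
    using k g l by (simp add: monomial_mult_monomial one_eq_monomial F.Units_closed del: F.Units_r_inv)
qed

text \<open>The right inverse has a right inverse in turn. Having an inverse on both sides, it
  forces the two to coincide, so the one-sided computation gives a two-sided inverse.\<close>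

lemma monomial_inv:
  assumes k: "k \<in> carrier F" "k \<noteq> \<zero>\<^bsub>F\<^esub>" and g: "g \<in> carrier A"
  obtains l where "l \<in> carrier F" "l \<noteq> \<zero>\<^bsub>F\<^esub>" "monomial k g \<in> Units R"
    "inv\<^bsub>R\<^esub> (monomial k g) = monomial l (inv\<^bsub>A\<^esub> g)"
proof -
  obtain l where l: "l \<in> carrier F" "l \<noteq> \<zero>\<^bsub>F\<^esub>" "monomial k g \<otimes>\<^bsub>R\<^esub> monomial l (inv\<^bsub>A\<^esub> g) = \<one>\<^bsub>R\<^esub>"
    using monomial_right_inverse[OF k g] .
  obtain k' where k': "k' \<in> carrier F" "monomial l (inv\<^bsub>A\<^esub> g) \<otimes>\<^bsub>R\<^esub> monomial k' g = \<one>\<^bsub>R\<^esub>"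
    using monomial_right_inverse[OF l(1,2), of "inv\<^bsub>A\<^esub> g"] g by (metis A.inv_inv A.inv_closed)
  have cl: "monomial k g \<in> carrier R" "monomial l (inv\<^bsub>A\<^esub> g) \<in> carrier R" "monomial k' g \<in> carrier R"
    using k l k' g by simp_all
  have "monomial k' g = monomial k g"
    using R.inv_unique[of "monomial k g" "monomial l (inv\<^bsub>A\<^esub> g)" "monomial k' g"] cl l(3) k'(2) by simp
  then have inv: "monomial l (inv\<^bsub>A\<^esub> g) \<otimes>\<^bsub>R\<^esub> monomial k g = \<one>\<^bsub>R\<^esub>" using k'(2) by simp
  then have "monomial k g \<in> Units R" using cl l(3) by (auto simp: Units_def)
  moreover have "inv\<^bsub>R\<^esub> (monomial k g) = monomial l (inv\<^bsub>A\<^esub> g)"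
    using R.inv_char[OF cl(1,2) l(3) inv] .
  ultimately show ?thesis using that l by blast
qed

text \<open>Each multiplication contributes a value of the cocycle, and exponent zero contributes
  \<open>(lam 1 1)^-1\<close>. Only the nonvanishing of the accumulated scalar is recorded.\<close>

lemma monomial_nat_pow:
  assumes g: "g \<in> carrier A"
  shows "\<exists>k\<in>carrier F - {\<zero>\<^bsub>F\<^esub>}. monomial \<one>\<^bsub>F\<^esub> g [^]\<^bsub>R\<^esub> (n::nat) = monomial k (g [^]\<^bsub>A\<^esub> n)"
proof (induction n)
  case 0
  show ?case using inv_lam_one_Units by (auto simp: one_eq_monomial F.field_Units)
next
  case (Suc n)
  then obtain k where k: "k \<in> carrier F" "k \<noteq> \<zero>\<^bsub>F\<^esub>"
    "monomial \<one>\<^bsub>F\<^esub> g [^]\<^bsub>R\<^esub> n = monomial k (g [^]\<^bsub>A\<^esub> n)" by blast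
  have "monomial \<one>\<^bsub>F\<^esub> g [^]\<^bsub>R\<^esub> Suc n = monomial (lam (g [^]\<^bsub>A\<^esub> n) g \<otimes>\<^bsub>F\<^esub> (k \<otimes>\<^bsub>F\<^esub> \<one>\<^bsub>F\<^esub>)) (g [^]\<^bsub>A\<^esub> Suc n)"
    using k(1) g monomial_mult_monomial[of k "\<one>\<^bsub>F\<^esub>" "g [^]\<^bsub>A\<^esub> n" g] by (simp add: k(3))
  moreover have "lam (g [^]\<^bsub>A\<^esub> n) g \<otimes>\<^bsub>F\<^esub> (k \<otimes>\<^bsub>F\<^esub> \<one>\<^bsub>F\<^esub>) \<in> carrier F - {\<zero>\<^bsub>F\<^esub>}"
    using k g by (simp add: F.integral_iff)
  ultimately show ?case by blast
qed

lemma monomial_int_pow: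
  assumes g: "g \<in> carrier A"
  shows "\<exists>k\<in>carrier F - {\<zero>\<^bsub>F\<^esub>}. monomial \<one>\<^bsub>F\<^esub> g [^]\<^bsub>R\<^esub> (i::int) = monomial k (g [^]\<^bsub>A\<^esub> i)"
proof (cases "i < 0")
  case True
  obtain k where k: "k \<in> carrier F" "k \<noteq> \<zero>\<^bsub>F\<^esub>"
    and eq: "monomial \<one>\<^bsub>F\<^esub> g [^]\<^bsub>R\<^esub> nat (- i) = monomial k (g [^]\<^bsub>A\<^esub> nat (- i))"
    using monomial_nat_pow[OF g, of "nat (- i)"] by blast
  have gn: "g [^]\<^bsub>A\<^esub> nat (- i) \<in> carrier A" using g by (rule A.nat_pow_closed)
  obtain l where l: "l \<in> carrier F" "l \<noteq> \<zero>\<^bsub>F\<^esub>"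
    "inv\<^bsub>R\<^esub> (monomial k (g [^]\<^bsub>A\<^esub> nat (- i))) = monomial l (inv\<^bsub>A\<^esub> (g [^]\<^bsub>A\<^esub> nat (- i)))"
    using monomial_inv[OF k gn] by blast
  have "monomial \<one>\<^bsub>F\<^esub> g [^]\<^bsub>R\<^esub> i = monomial l (g [^]\<^bsub>A\<^esub> i)"
    unfolding int_pow_def2 using True l(3) by (simp only: if_True eq)
  then show ?thesis using l by blast
next
  case False
  then show ?thesis
    unfolding int_pow_def2 using monomial_nat_pow[OF g, of "nat i"] by (simp only: if_False)
qed

section \<open>Simplicity when the center consists of scalars\<close>

lemma ideal_element_with_one_in_supp:
  assumes "ideal T R" and y: "y \<in> T" "y \<noteq> \<zero>\<^bsub>R\<^esub>"
  shows "\<exists>z\<in>T. z \<one>\<^bsub>A\<^esub> \<noteq> \<zero>\<^bsub>F\<^esub> \<and> card (supp F z) \<le> card (supp F y)"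
proof -
  interpret T: ideal T R by fact
  have yc: "y \<in> carrier R" using y T.a_subset by blast
  obtain d where d: "y d \<noteq> \<zero>\<^bsub>F\<^esub>" using y(2) by (metis tga_zero ext)
  then have dc: "d \<in> carrier A" using coeff_outside[OF yc] by blast
  \<comment> \<open>This translates the support by \<open>d^-1\<close>: the point \<open>d\<close>
    moves to the identity and the number of points does not grow.\<close>
  let ?z = "y \<otimes>\<^bsub>R\<^esub> monomial \<one>\<^bsub>F\<^esub> (inv\<^bsub>A\<^esub> d)"
  have "?z \<in> T" using T.I_r_closed[OF y(1)] dc by simp
  moreover have "?z \<one>\<^bsub>A\<^esub> \<noteq> \<zero>\<^bsub>F\<^esub>"
    using mult_monomial_coeff[of "\<one>\<^bsub>F\<^esub>" "inv\<^bsub>A\<^esub> d" y d] d dc yc coeff_closed[OF yc]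
    by (simp add: F.integral_iff)
  moreover have "supp F ?z \<subseteq> (\<lambda>a. a \<otimes>\<^bsub>A\<^esub> inv\<^bsub>A\<^esub> d) ` supp F y"
    using mult_supp[OF yc, of "monomial \<one>\<^bsub>F\<^esub> (inv\<^bsub>A\<^esub> d)"] supp_monomial[of "\<one>\<^bsub>F\<^esub>" "inv\<^bsub>A\<^esub> d"] dc by fastforce
  then have "card (supp F ?z) \<le> card (supp F y)"
    using finite_supp[OF yc] by (meson card_image_le card_mono finite_imageI le_trans)
  ultimately show ?thesis by blast
qed

text \<open>As \<open>c d = d c\<close>, both products have at this point a multiple of
  \<open>x d\<close>, so the support lies in a translate of that of \<open>x\<close>. At
  \<open>d = 1\<close> the two multiples agree because \<open>lam c 1 = lam 1 c\<close>, and the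
  identity drops out.\<close>

lemma commutator_supp:
  assumes "comm_group A" and k: "k \<in> carrier F" and c: "c \<in> carrier A" and x: "x \<in> carrier R"
  shows "supp F (monomial k c \<otimes>\<^bsub>R\<^esub> x \<ominus>\<^bsub>R\<^esub> x \<otimes>\<^bsub>R\<^esub> monomial k c) \<subseteq> (\<lambda>d. c \<otimes>\<^bsub>A\<^esub> d) ` (supp F x - {\<one>\<^bsub>A\<^esub>})"
proof
  interpret comm_group A by fact
  let ?y = "monomial k c \<otimes>\<^bsub>R\<^esub> x \<ominus>\<^bsub>R\<^esub> x \<otimes>\<^bsub>R\<^esub> monomial k c"
  have m: "monomial k c \<in> carrier R" using k c by simp
  have cl: "monomial k c \<otimes>\<^bsub>R\<^esub> x \<in> carrier R" "x \<otimes>\<^bsub>R\<^esub> monomial k c \<in> carrier R"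
    using m x by (simp_all add: mult_closed)
  fix e assume e: "e \<in> supp F ?y"
  have "?y \<in> carrier R" using cl by simp
  then have ec: "e \<in> carrier A" using e supp_subset by blast
  define d where "d = inv\<^bsub>A\<^esub> c \<otimes>\<^bsub>A\<^esub> e"
  have d: "d \<in> carrier A" "e = c \<otimes>\<^bsub>A\<^esub> d" using c ec by (simp_all add: d_def)
  have xd: "x d \<in> carrier F" by (rule coeff_closed[OF x])
  have "?y e = lam c d \<otimes>\<^bsub>F\<^esub> (k \<otimes>\<^bsub>F\<^esub> x d) \<oplus>\<^bsub>F\<^esub> \<ominus>\<^bsub>F\<^esub> (lam d c \<otimes>\<^bsub>F\<^esub> (x d \<otimes>\<^bsub>F\<^esub> k))"
  proof -
    have "(x \<otimes>\<^bsub>R\<^esub> monomial k c) e = lam d c \<otimes>\<^bsub>F\<^esub> (x d \<otimes>\<^bsub>F\<^esub> k)"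
      using mult_monomial_coeff[OF k c x d(1)] m_comm[OF c d(1)] d(2) by (simp only:)
    moreover have "(monomial k c \<otimes>\<^bsub>R\<^esub> x) e = lam c d \<otimes>\<^bsub>F\<^esub> (k \<otimes>\<^bsub>F\<^esub> x d)"
      using monomial_mult_coeff[OF k c x d(1)] d(2) by (simp only:)
    ultimately show ?thesis by (simp only: a_minus_def tga_add neg_coeff[OF cl(2)])
  qed
  moreover have "?y e \<noteq> \<zero>\<^bsub>F\<^esub>" using e by (simp add: supp_def)
  ultimately have nz: "lam c d \<otimes>\<^bsub>F\<^esub> (k \<otimes>\<^bsub>F\<^esub> x d) \<oplus>\<^bsub>F\<^esub> \<ominus>\<^bsub>F\<^esub> (lam d c \<otimes>\<^bsub>F\<^esub> (x d \<otimes>\<^bsub>F\<^esub> k)) \<noteq> \<zero>\<^bsub>F\<^esub>"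
    by simp
  have "x d \<noteq> \<zero>\<^bsub>F\<^esub>" using nz c d(1) k by auto
  moreover have "d \<noteq> \<one>\<^bsub>A\<^esub>"
  proof
    assume "d = \<one>\<^bsub>A\<^esub>"
    then have "lam c d = lam d c" using lam_one_left[OF c] lam_one_right[OF c] by (simp only:)
    then show False using nz c d(1) k xd by (simp add: F.m_comm[OF k xd] F.r_neg)
  qed
  ultimately show "e \<in> (\<lambda>d. c \<otimes>\<^bsub>A\<^esub> d) ` (supp F x - {\<one>\<^bsub>A\<^esub>})"
    using d by (auto simp: supp_def)
qed

lemma central_if_commutes_with_monomials:
  assumes x: "x \<in> carrier R"
    and comm: "\<And>k c. \<lbrakk>k \<in> carrier F; c \<in> carrier A\<rbrakk> \<Longrightarrow> monomial k c \<otimes>\<^bsub>R\<^esub> x = x \<otimes>\<^bsub>R\<^esub> monomial k c"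
  shows "x \<in> ring_center R"
proof -
  have "x \<otimes>\<^bsub>R\<^esub> y = y \<otimes>\<^bsub>R\<^esub> x" if "y \<in> carrier R" for y
    using that by (induction y rule: R_induct)
      (simp_all add: comm zero_mult mult_zero l_distr r_distr x)
  then show ?thesis using x by (simp add: ring_center_def)
qed

theorem simple_if_center_scalars:
  assumes comm: "comm_group A" and center: "ring_center R = tga_scalars F A lam"
    and "ideal T R" and "T \<noteq> {\<zero>\<^bsub>R\<^esub>}"
  shows "T = carrier R"
proof -
  interpret T: ideal T R by fact
  let ?P = "\<lambda>x. x \<in> T \<and> x \<one>\<^bsub>A\<^esub> \<noteq> \<zero>\<^bsub>F\<^esub>"
  obtain y where "y \<in> T" "y \<noteq> \<zero>\<^bsub>R\<^esub>" using \<open>T \<noteq> {\<zero>\<^bsub>R\<^esub>}\<close> T.zero_closed by blast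
  then have "\<exists>x. ?P x" using ideal_element_with_one_in_supp[OF \<open>ideal T R\<close>] by blast
  then obtain x where x: "?P x" and min: "\<And>z. ?P z \<Longrightarrow> card (supp F x) \<le> card (supp F z)"
    using ex_has_least_nat[of ?P _ "\<lambda>x. card (supp F x)"] by blast
  have xT: "x \<in> T" and xc: "x \<in> carrier R" using x T.a_subset by blast+
  have "x \<in> ring_center R"
  proof (rule central_if_commutes_with_monomials[OF xc])
    fix k c assume k: "k \<in> carrier F" and c: "c \<in> carrier A"
    let ?y = "monomial k c \<otimes>\<^bsub>R\<^esub> x \<ominus>\<^bsub>R\<^esub> x \<otimes>\<^bsub>R\<^esub> monomial k c"
    have m: "monomial k c \<in> carrier R" using k c by simp
    have cl: "monomial k c \<otimes>\<^bsub>R\<^esub> x \<in> carrier R" "x \<otimes>\<^bsub>R\<^esub> monomial k c \<in> carrier R"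
      using m xc by (simp_all add: mult_closed)
    have "?y \<in> T"
      unfolding a_minus_def using T.I_l_closed[OF xT m] T.I_r_closed[OF xT m]
      by (intro T.a_closed T.a_inv_closed)
    have "?y = \<zero>\<^bsub>R\<^esub>"
    \<comment> \<open>A nonzero commutator could be translated within \<open>T\<close> to an element
      satisfying \<open>?P\<close> whose support is strictly smaller than that of
      \<open>x\<close>.\<close>
    proof (rule ccontr)
      assume "?y \<noteq> \<zero>\<^bsub>R\<^esub>"
      then obtain z where "?P z" "card (supp F z) \<le> card (supp F ?y)"
        using ideal_element_with_one_in_supp[OF \<open>ideal T R\<close> \<open>?y \<in> T\<close>] by blast
      moreover have "card (supp F ?y) \<le> card (supp F x - {\<one>\<^bsub>A\<^esub>})"
        using commutator_supp[OF comm k c xc] finite_supp[OF xc]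
        by (meson card_image_le card_mono finite_Diff finite_imageI le_trans)
      moreover have "card (supp F x - {\<one>\<^bsub>A\<^esub>}) < card (supp F x)"
        using x finite_supp[OF xc] by (intro card_Diff1_less) (auto simp: supp_def)
      ultimately show False using min[of z] by linarith
    qed
    then show "monomial k c \<otimes>\<^bsub>R\<^esub> x = x \<otimes>\<^bsub>R\<^esub> monomial k c"
      using cl by simp
  qed
  then obtain k where k: "k \<in> carrier F" "x = (\<lambda>a. k \<otimes>\<^bsub>F\<^esub> \<one>\<^bsub>R\<^esub> a)"
    unfolding center tga_scalars_def by blast
  let ?k = "k \<otimes>\<^bsub>F\<^esub> inv\<^bsub>F\<^esub> lam \<one>\<^bsub>A\<^esub> \<one>\<^bsub>A\<^esub>"
  have kc: "?k \<in> carrier F" using k by (simp add: F.field_Units)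
  have eq: "x = monomial ?k \<one>\<^bsub>A\<^esub>"
    unfolding k(2) one_eq_monomial using k(1) by (auto simp: monomial_apply)
  \<comment> \<open>\<open>?k\<close> is the coefficient of \<open>x\<close> at the identity,
    nonzero by the choice of \<open>x\<close>; hence the ideal contains an invertible
    scalar.\<close>
  then have "?k \<noteq> \<zero>\<^bsub>F\<^esub>" using x by (auto simp: monomial_apply)
  then obtain l where l: "l \<in> carrier F" "x \<otimes>\<^bsub>R\<^esub> monomial l (inv\<^bsub>A\<^esub> \<one>\<^bsub>A\<^esub>) = \<one>\<^bsub>R\<^esub>"
    using monomial_right_inverse[OF kc _ A.one_closed] eq by metis
  then have "\<one>\<^bsub>R\<^esub> \<in> T" using T.I_r_closed[OF xT, of "monomial l (inv\<^bsub>A\<^esub> \<one>\<^bsub>A\<^esub>)"] by simp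
  then show ?thesis by (rule T.one_imp_carrier)
qed

section \<open>The subalgebra \<open>F * B\<close> and one-sided multiples\<close>

lemma mem_tga_supported: "x \<in> tga_supported F A lam B \<longleftrightarrow> x \<in> carrier R \<and> supp F x \<subseteq> B"
  by (simp add: tga_supported_def)

lemma subring_tga_supported:
  assumes "subgroup B A"
  shows "subring (tga_supported F A lam B) R"
proof (rule R.subringI)
  interpret B: subgroup B A by fact
  show "\<one>\<^bsub>R\<^esub> \<in> tga_supported F A lam B"
    using supp_monomial[of "inv\<^bsub>F\<^esub> lam \<one>\<^bsub>A\<^esub> \<one>\<^bsub>A\<^esub>" "\<one>\<^bsub>A\<^esub>"] one_closed B.one_closed
    unfolding mem_tga_supported one_eq_monomial by blast
  fix x assume "x \<in> tga_supported F A lam B"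
  then have x: "x \<in> carrier R" "supp F x \<subseteq> B" by (simp_all add: mem_tga_supported)
  have "supp F (\<ominus>\<^bsub>R\<^esub> x) \<subseteq> supp F x" by (auto simp: supp_def neg_coeff[OF x(1)])
  then show "\<ominus>\<^bsub>R\<^esub> x \<in> tga_supported F A lam B" using x by (simp add: mem_tga_supported)
  fix y assume "y \<in> tga_supported F A lam B"
  then have y: "y \<in> carrier R" "supp F y \<subseteq> B" by (simp_all add: mem_tga_supported)
  have "supp F (x \<oplus>\<^bsub>R\<^esub> y) \<subseteq> supp F x \<union> supp F y" by (auto simp: supp_def tga_add)
  then show "x \<oplus>\<^bsub>R\<^esub> y \<in> tga_supported F A lam B" using x y by (auto simp: mem_tga_supported)
  have "e \<in> B" if e: "e \<in> supp F (x \<otimes>\<^bsub>R\<^esub> y)" for e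
  proof -
    obtain a b where "a \<in> supp F x" "b \<in> supp F y" "e = a \<otimes>\<^bsub>A\<^esub> b"
      using subsetD[OF mult_supp[OF x(1) y(1)] e] by auto
    then show ?thesis using x(2) y(2) by (simp add: B.m_closed subset_iff)
  qed
  then show "x \<otimes>\<^bsub>R\<^esub> y \<in> tga_supported F A lam B"
    using x(1) y(1) by (simp add: mem_tga_supported mult_closed subset_iff)
next
  show "tga_supported F A lam B \<subseteq> carrier R" by (simp add: mem_tga_supported subset_iff)
qed

text \<open>Conjugation by a monomial moves a support point \<open>a\<close> to
  \<open>g^-1 a g\<close>, which is \<open>a\<close> in a commutative group; only coefficients
  change.\<close>

lemma conj_tga_supported:
  assumes "comm_group A" and b: "b \<in> tga_supported F A lam B"
    and k: "k \<in> carrier F" "k \<noteq> \<zero>\<^bsub>F\<^esub>" and g: "g \<in> carrier A"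
  shows "inv\<^bsub>R\<^esub> (monomial k g) \<otimes>\<^bsub>R\<^esub> b \<otimes>\<^bsub>R\<^esub> monomial k g \<in> tga_supported F A lam B"
proof -
  interpret comm_group A by fact
  obtain l where l: "l \<in> carrier F" "inv\<^bsub>R\<^esub> (monomial k g) = monomial l (inv\<^bsub>A\<^esub> g)"
    using monomial_inv[OF k g] by blast
  have bc: "b \<in> carrier R" "supp F b \<subseteq> B" using b by (simp_all add: mem_tga_supported)
  let ?m = "monomial l (inv\<^bsub>A\<^esub> g)" and ?n = "monomial k g"
  have cl: "?m \<in> carrier R" "?n \<in> carrier R" using l k g by simp_all
  have mb: "?m \<otimes>\<^bsub>R\<^esub> b \<in> carrier R" using cl bc by (simp add: mult_closed)
  have "e \<in> B" if e: "e \<in> supp F (?m \<otimes>\<^bsub>R\<^esub> b \<otimes>\<^bsub>R\<^esub> ?n)" for e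
  proof -
    obtain d where d: "d \<in> supp F (?m \<otimes>\<^bsub>R\<^esub> b)" "e = d \<otimes>\<^bsub>A\<^esub> g"
      using subsetD[OF mult_supp[OF mb cl(2)] e] supp_monomial[of k g] by auto
    obtain a where a: "a \<in> supp F b" "d = inv\<^bsub>A\<^esub> g \<otimes>\<^bsub>A\<^esub> a"
      using subsetD[OF mult_supp[OF cl(1) bc(1)] d(1)] supp_monomial[of l "inv\<^bsub>A\<^esub> g"] by auto
    have ac: "a \<in> carrier A" using a(1) supp_subset[OF bc(1)] by blast
    have "e = a" using d(2) a(2) g ac m_comm[of "inv\<^bsub>A\<^esub> g \<otimes>\<^bsub>A\<^esub> a" g] by simp
    then show ?thesis using a(1) bc(2) by blast
  qed
  then show ?thesis unfolding l(2) using mb cl by (auto simp: mem_tga_supported mult_closed)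
qed

text \<open>By additivity \<open>y\<close> may be a monomial. It factors as a power of the basis
  element of \<open>t\<close> times a monomial of \<open>F * B\<close>; the latter commutes with
  \<open>s\<close> and ends up on the right, where \<open>J\<close> absorbs it.\<close>

lemma all_multiples_in:
  assumes "comm_group A" and "subgroup B A" and t: "t \<in> carrier A"
    and gen: "carrier (A Mod B) = generate (A Mod B) {B #>\<^bsub>A\<^esub> t}"
    and "right_ideal J R"
    and comm: "\<forall>x\<in>tga_supported F A lam B. \<forall>y\<in>tga_supported F A lam B. x \<otimes>\<^bsub>R\<^esub> y = y \<otimes>\<^bsub>R\<^esub> x"
    and s: "s \<in> tga_supported F A lam B"
    and J: "\<And>i::int. tga_basis F t [^]\<^bsub>R\<^esub> i \<otimes>\<^bsub>R\<^esub> s \<in> J"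
    and y: "y \<in> carrier R"
  shows "y \<otimes>\<^bsub>R\<^esub> s \<in> J"
proof -
  interpret B: subgroup B A by fact
  interpret J: right_ideal J R by fact
  have sc: "s \<in> carrier R" using s by (simp add: mem_tga_supported)
  show ?thesis using y
  proof (induction y rule: R_induct)
    case zero
    show ?case using sc J.zero_closed by simp
  next
    case (add x y)
    then show ?case using sc J.a_closed by (simp add: R.l_distr)
  next
    case (monomial k g)
    obtain b and i :: int where b: "b \<in> B" and g: "g = t [^]\<^bsub>A\<^esub> i \<otimes>\<^bsub>A\<^esub> b"
      using comm_group.cyclic_quotient_cover[OF assms(1,2) t gen monomial(2)] by blast
    have bc: "b \<in> carrier A" using b by (rule B.mem_carrier)
    have ti: "t [^]\<^bsub>A\<^esub> i \<in> carrier A" using t by (rule A.int_pow_closed)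
    obtain c where c: "c \<in> carrier F" "c \<noteq> \<zero>\<^bsub>F\<^esub>"
      and pow: "tga_basis F t [^]\<^bsub>R\<^esub> i = monomial c (t [^]\<^bsub>A\<^esub> i)"
      using monomial_int_pow[OF t, of i] unfolding tga_basis_eq_monomial by blast
    let ?d = "lam (t [^]\<^bsub>A\<^esub> i) b \<otimes>\<^bsub>F\<^esub> c"
    \<comment> \<open>This coefficient compensates the scalar \<open>c\<close> in the power of the
      basis element of \<open>t\<close> and the cocycle value arising in the product.\<close>
    let ?l = "inv\<^bsub>F\<^esub> ?d \<otimes>\<^bsub>F\<^esub> k"
    have d: "?d \<in> Units F" using c ti bc by (simp add: F.field_Units F.integral_iff)
    have dc: "inv\<^bsub>F\<^esub> ?d \<in> carrier F" using d by (rule F.Units_inv_closed)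
    have l: "?l \<in> carrier F" using dc monomial(1) by (rule F.m_closed)
    have "lam (t [^]\<^bsub>A\<^esub> i) b \<otimes>\<^bsub>F\<^esub> (c \<otimes>\<^bsub>F\<^esub> ?l) = ?d \<otimes>\<^bsub>F\<^esub> inv\<^bsub>F\<^esub> ?d \<otimes>\<^bsub>F\<^esub> k"
      using c(1) ti bc dc monomial(1) by (simp add: F.m_assoc del: F.Units_r_inv)
    also have "\<dots> = k" using F.Units_r_inv[OF d] monomial(1) by simp
    finally have "monomial k g = monomial c (t [^]\<^bsub>A\<^esub> i) \<otimes>\<^bsub>R\<^esub> monomial ?l b"
      using monomial_mult_monomial[OF c(1) l ti bc] g by simp
    moreover have m: "monomial ?l b \<in> tga_supported F A lam B"
      using l bc b supp_monomial[of ?l b] by (auto simp: mem_tga_supported)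
    moreover have mc: "monomial ?l b \<in> carrier R" using l bc by simp
    moreover have "monomial ?l b \<otimes>\<^bsub>R\<^esub> s = s \<otimes>\<^bsub>R\<^esub> monomial ?l b" using comm m s by blast
    moreover have pc: "monomial c (t [^]\<^bsub>A\<^esub> i) \<in> carrier R" using c ti by simp
    ultimately have "monomial k g \<otimes>\<^bsub>R\<^esub> s = monomial c (t [^]\<^bsub>A\<^esub> i) \<otimes>\<^bsub>R\<^esub> s \<otimes>\<^bsub>R\<^esub> monomial ?l b"
      using sc by (simp add: R.m_assoc)
    then show ?case using J.I_r_closed[OF J[of i] mc] by (simp add: pow)
  qed
qed

lemma right_ideal_eq_carrier:
  assumes "comm_group A" and center: "ring_center R = tga_scalars F A lam"
    and "right_ideal J R" and s: "s \<in> carrier R" "s \<noteq> \<zero>\<^bsub>R\<^esub>"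
    and J: "\<And>y. y \<in> carrier R \<Longrightarrow> y \<otimes>\<^bsub>R\<^esub> s \<in> J"
  shows "J = carrier R"
proof -
  interpret J: right_ideal J R by fact
  \<comment> \<open>The annihilator of the right module \<open>R / J\<close>; it lies inside
    \<open>J\<close>, as \<open>y = 1\<close> shows, and contains \<open>s\<close>.\<close>
  let ?T = "{x \<in> carrier R. \<forall>y\<in>carrier R. y \<otimes>\<^bsub>R\<^esub> x \<in> J}"
  have right: "right_ideal ?T R"
    by (rule right_idealI[OF ring_R])
      (auto simp: J.zero_closed R.r_distr J.a_closed J.I_r_closed simp flip: R.m_assoc)
  have "ideal ?T R"
  proof (intro ideal.intro ideal_axioms.intro ring_R)
    show "additive_subgroup ?T R" using right by (rule right_ideal.axioms)
    show "x \<otimes>\<^bsub>R\<^esub> a \<in> ?T" if "a \<in> ?T" "x \<in> carrier R" for a x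
      using that by (auto simp flip: R.m_assoc)
    show "a \<otimes>\<^bsub>R\<^esub> x \<in> ?T" if "a \<in> ?T" "x \<in> carrier R" for a x
      using right_ideal.I_r_closed[OF right that] .
  qed
  moreover have "s \<in> ?T" using s J by blast
  then have "?T \<noteq> {\<zero>\<^bsub>R\<^esub>}" using s(2) by blast
  ultimately have T: "?T = carrier R" by (rule simple_if_center_scalars[OF assms(1) center])
  have "x \<in> J" if x: "x \<in> carrier R" for x
  proof -
    have "x \<in> ?T" using x T by blast
    then have "\<one>\<^bsub>R\<^esub> \<otimes>\<^bsub>R\<^esub> x \<in> J" by blast
    then show ?thesis using x by simp
  qed
  then show ?thesis using J.a_subset by blast
qed

end

section \<open>Simplicity of the quotient module\<close>

theorem theorem2p12:
  fixes F :: "('f, 'm) ring_scheme"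
    and A :: "('a, 'n) monoid_scheme"
    and lam :: "'a \<Rightarrow> 'a \<Rightarrow> 'f"
    and B :: "'a set"
    and t :: 'a
    and \<Sigma> :: "('q, 'k) ring_scheme"
    and \<iota> :: "('a \<Rightarrow> 'f) \<Rightarrow> 'q"
    and \<mm> :: "'q set"
  defines "\<A> \<equiv> twisted_group_algebra F A lam"
    and "\<B> \<equiv> tga_supported F A lam B"
  defines "I \<equiv> {\<alpha> \<in> carrier \<A>. \<iota> \<alpha> \<in> \<mm>}"
  assumes "field F"
    and "comm_group A" and "finitely_generated_group A" and "torsion_free_group A"
    and "two_cocycle F A lam"
    and "subgroup B A"
    and "t \<in> carrier A"
    and "carrier (A Mod B) = generate (A Mod B) {B #>\<^bsub>A\<^esub> t}" and "infinite (carrier (A Mod B))"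
    and "right_ring_of_fractions \<A> (\<B> - {\<zero>\<^bsub>\<A>\<^esub>}) \<Sigma> \<iota>"
    and "maximal_right_ideal \<mm> \<Sigma>"
    and "\<forall>\<alpha>\<in>\<B>. \<forall>\<beta>\<in>\<B>. \<alpha> \<otimes>\<^bsub>\<A>\<^esub> \<beta> = \<beta> \<otimes>\<^bsub>\<A>\<^esub> \<alpha>"
    and "ring_center \<A> = tga_scalars F A lam"
    and "\<exists>\<alpha>\<in>I. unitary_wrt \<A> \<B> (tga_basis F t) \<alpha>"
  shows "simple_right_module \<A> (right_quotient_module \<A> I)"
proof (rule maximal_imp_simple_quotient)
  note A = \<open>comm_group A\<close> and t = \<open>t \<in> carrier A\<close>
    and frac = \<open>right_ring_of_fractions \<A> (\<B> - {\<zero>\<^bsub>\<A>\<^esub>}) \<Sigma> \<iota>\<close> and max = \<open>maximal_right_ideal \<mm> \<Sigma>\<close>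
    and comm = \<open>\<forall>\<alpha>\<in>\<B>. \<forall>\<beta>\<in>\<B>. \<alpha> \<otimes>\<^bsub>\<A>\<^esub> \<beta> = \<beta> \<otimes>\<^bsub>\<A>\<^esub> \<alpha>\<close>
    and B = \<open>subgroup B A\<close>
  interpret tga F A lam
    using \<open>field F\<close> A \<open>two_cocycle F A lam\<close>
    by (intro tga.intro tga_axioms.intro comm_group.axioms(2))
  interpret A: ring \<A> unfolding \<A>_def by (rule ring_R)
  interpret \<Sigma>: ring \<Sigma> using frac by (simp add: right_ring_of_fractions_def)
  interpret \<iota>: ring_hom_ring \<A> \<Sigma> \<iota>
    using frac by (intro ring_hom_ringI2 A.ring_axioms \<Sigma>.ring_axioms) (simp add: right_ring_of_fractions_def)
  interpret \<mm>: right_ideal \<mm> \<Sigma> using max by (simp add: maximal_right_ideal_def)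
  have proper: "\<one>\<^bsub>\<Sigma>\<^esub> \<notin> \<mm>"
  proof
    assume one: "\<one>\<^bsub>\<Sigma>\<^esub> \<in> \<mm>"
    have "x \<in> \<mm>" if "x \<in> carrier \<Sigma>" for x using \<mm>.I_r_closed[OF one that] that by simp
    then show False using max \<mm>.a_subset unfolding maximal_right_ideal_def by blast
  qed
  \<comment> \<open>A proper right ideal omits one but contains zero; with this the denominators
    multiply to nonzero elements.\<close>
  then have nontrivial: "\<one>\<^bsub>\<Sigma>\<^esub> \<noteq> \<zero>\<^bsub>\<Sigma>\<^esub>" using \<mm>.zero_closed by metis
  have subring: "subring \<B> \<A>" unfolding \<A>_def \<B>_def by (rule subring_tga_supported[OF B])
  have dc: "\<B> - {\<zero>\<^bsub>\<A>\<^esub>} \<subseteq> carrier \<A>" using subringE(1)[OF subring] by blast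
  have pow: "\<exists>k\<in>carrier F - {\<zero>\<^bsub>F\<^esub>}. tga_basis F t [^]\<^bsub>\<A>\<^esub> i = monomial k (t [^]\<^bsub>A\<^esub> i)" for i :: int
    unfolding \<A>_def tga_basis_eq_monomial by (rule monomial_int_pow[OF t])
  interpret normalized_subring \<A> \<B> "tga_basis F t"
  proof (intro normalized_subring.intro normalized_subring_axioms.intro A.ring_axioms subring)
    show "tga_basis F t \<in> Units \<A>"
      unfolding \<A>_def tga_basis_eq_monomial using monomial_inv[OF _ _ t] by (metis F.one_closed F.one_not_zero)
    show "x \<otimes>\<^bsub>\<A>\<^esub> y = y \<otimes>\<^bsub>\<A>\<^esub> x" if "x \<in> \<B>" "y \<in> \<B>" for x y using comm that by blast
    show "x = \<zero>\<^bsub>\<A>\<^esub> \<or> y = \<zero>\<^bsub>\<A>\<^esub>" if "x \<in> \<B>" "y \<in> \<B>" "x \<otimes>\<^bsub>\<A>\<^esub> y = \<zero>\<^bsub>\<A>\<^esub>" for x y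
      using denominators_mult_nonzero[OF A.ring_axioms frac dc nontrivial] that by blast
    show "inv\<^bsub>\<A>\<^esub> (tga_basis F t [^]\<^bsub>\<A>\<^esub> i) \<otimes>\<^bsub>\<A>\<^esub> b \<otimes>\<^bsub>\<A>\<^esub> tga_basis F t [^]\<^bsub>\<A>\<^esub> i \<in> \<B>"
      if "b \<in> \<B>" for b and i :: int
    proof -
      obtain k where k: "k \<in> carrier F" "k \<noteq> \<zero>\<^bsub>F\<^esub>"
        and eq: "tga_basis F t [^]\<^bsub>\<A>\<^esub> i = monomial k (t [^]\<^bsub>A\<^esub> i)" using pow by blast
      show ?thesis
        unfolding eq using conj_tga_supported[OF A _ k A.int_pow_closed[OF t]] that
        unfolding \<A>_def \<B>_def by blast
    qed
  qed
  have I: "right_ideal I \<A>"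
    unfolding I_def by (rule right_ideal_preimage[OF \<iota>.ring_hom_ring_axioms \<mm>.right_ideal_axioms])
  have "\<one>\<^bsub>\<A>\<^esub> \<notin> I" using proper by (simp add: I_def)
  then have "I \<noteq> carrier \<A>" using A.one_closed by blast
  moreover have "J = carrier \<A>" if J: "right_ideal J \<A>" "I \<subseteq> J" "J \<noteq> I" for J
  proof -
    interpret J: right_ideal J \<A> by (rule J(1))
    obtain x where x: "x \<in> J" "x \<notin> I" using J by blast
    \<comment> \<open>Since \<open>I\<close> is the full preimage of \<open>\<mm>\<close>, an
      element of \<open>J\<close> outside \<open>I\<close> stays outside \<open>\<mm>\<close>, as
      required for producing a denominator in \<open>J\<close>.\<close>
    then have "\<iota> x \<notin> \<mm>" using J.a_subset by (auto simp: I_def)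
    then obtain s0 where s0: "s0 \<in> \<B>" "s0 \<in> J" "s0 \<noteq> \<zero>\<^bsub>\<A>\<^esub>"
      using right_ideal_meets_denominators[OF A.ring_axioms frac dc max J(1) J(2)[unfolded I_def] x(1)] by blast
    obtain \<alpha> where \<alpha>: "\<alpha> \<in> J" "unitary_wrt \<A> \<B> (tga_basis F t) \<alpha>"
      using \<open>\<exists>\<alpha>\<in>I. unitary_wrt \<A> \<B> (tga_basis F t) \<alpha>\<close> J(2) by blast
    obtain s where s: "s \<in> \<B>" "s \<noteq> \<zero>\<^bsub>\<A>\<^esub>"
      and powers: "\<And>i::int. tga_basis F t [^]\<^bsub>\<A>\<^esub> i \<otimes>\<^bsub>\<A>\<^esub> s \<in> J"
      using exists_annihilator_of_powers[OF J(1) s0 \<alpha>] by blast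
    have "y \<otimes>\<^bsub>\<A>\<^esub> s \<in> J" if "y \<in> carrier \<A>" for y
      using all_multiples_in[OF A B t \<open>carrier (A Mod B) = _\<close>] J(1) comm s(1) powers that
      unfolding \<A>_def \<B>_def by blast
    then show ?thesis
      using right_ideal_eq_carrier[OF A] \<open>ring_center \<A> = _\<close> J(1) K_closed[OF s(1)] s(2)
      unfolding \<A>_def by blast
  qed
  ultimately show "maximal_right_ideal I \<A>"
    using I unfolding maximal_right_ideal_def by blast
qed

end
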